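(* Let $n$ and $k$ be positive integers with $n\ge 2k+1$, and let $f(n,k)$ denote the maximum size of a nonhamiltonian graph of order $n$ and connectivity $k$. Then $$ f(n,k)=\begin{cases} \binom{n-k}{2}+k^2 & \text{if } n \text{ is odd and } n\ge 6k-5, \text{ or } n \text{ is even and } n\ge 6k-8,\\[2pt] \frac{3n^2-8n+5}{8}+k & \text{if } n \text{ is odd and } 2k+1\le n\le 6k-7,\\[2pt] \frac{3n^2-10n+16}{8}+k & \text{if } n \text{ is even and } 2k+2\le n\le 6k-10. \end{cases} $$ Moreover, the extremal graphs (the nonhamiltonian graphs of order $n$ and connectivity $k$ whose size is $f(n,k)$) are, up to isomorphism, as follows. (i) If $n=6k-5$, then $f(n,k)$ is attained by a graph $G$ if and only if $G=K_k\vee(K_{n-2k}+\overline{K_k})$ or $G=G_1(n,k)$. (ii) If $n=6k-8$, then $f(n,k)$ is attained by a graph $G$ if and only if $G=K_k\vee(K_{n-2k}+\overline{K_k})$ or $G=G_2(n,k)$. (iii) If $n$ is odd and $n\ge 6k-3$, or $n$ is even and $n\ge 6k-6$, then $f(n,k)$ is attained by a graph $G$ if and only if $G=K_k\vee(K_{n-2k}+\overline{K_k})$. (iv) If $n$ is odd and $2k+1\le n\le 6k-7$, then $f(n,k)$ is attained by a graph $H$ if and only if $H=G_1(n,k)$. (v) If $n$ is even and $2k+2\le n\le 6k-10$, then $f(n,k)$ is attained by a graph $Z$ if and only if $Z=G_2(n,k)$.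
   Context: All graphs are finite and simple. The order of a graph is its number of vertices and its size is its number of edges. Equality of graphs means isomorphism. The connectivity of a graph is its vertex connectivity $\kappa$ (with $\kappa(K_n)=n-1$). $K_n$ is the complete graph of order $n$, $\overline{G}$ is the complement of $G$, $G+H$ is the disjoint union of $G$ and $H$, and $G\vee H$ is the join, obtained from $G+H$ by adding all edges between $V(G)$ and $V(H)$. A graph is hamiltonian if it contains a cycle through all its vertices, and nonhamiltonian otherwise. For positive integers $n,k$ with $n$ odd and $n\ge 2k+1$, $G_1(n,k)$ denotes the graph obtained from $K_{(n-1)/2}\vee\overline{K_{(n+1)/2}}$ by deleting $(n-1)/2-k$ edges that are incident to one common vertex in $\overline{K_{(n+1)/2}}$. For positive integers $n,k$ with $n$ even and $n\ge 2k+2$, $G_2(n,k)$ denotes the graph obtained from $K_{(n-2)/2}\vee(K_2+\overline{K_{(n-2)/2}})$ by deleting $(n-2)/2-k$ edges that are incident to one common vertex in $\overline{K_{(n-2)/2}}$. *)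

theory Defs
  imports Complex_Main
begin

record 'a ugraph =
  verts :: "'a set"
  edges :: "'a set set"

definition all_pairs :: "'a set \<Rightarrow> 'a set set" where
  "all_pairs V = {{u, v} | u v. u \<in> V \<and> v \<in> V \<and> u \<noteq> v}"

definition simple_graph :: "'a ugraph \<Rightarrow> bool" where
  "simple_graph G \<longleftrightarrow> finite (verts G) \<and> edges G \<subseteq> all_pairs (verts G)"

definition graph_order :: "'a ugraph \<Rightarrow> nat" where
  "graph_order G = card (verts G)"

definition graph_size :: "'a ugraph \<Rightarrow> nat" where
  "graph_size G = card (edges G)"

definition adj :: "'a ugraph \<Rightarrow> 'a \<Rightarrow> 'a \<Rightarrow> bool" where
  "adj G u v \<longleftrightarrow> {u, v} \<in> edges G"

definition graph_iso :: "'a ugraph \<Rightarrow> 'b ugraph \<Rightarrow> bool"  (infix "\<simeq>" 50) where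
  "G \<simeq> H \<longleftrightarrow> (\<exists>f. bij_betw f (verts G) (verts H) \<and>
     (\<forall>u \<in> verts G. \<forall>v \<in> verts G. adj G u v \<longleftrightarrow> adj H (f u) (f v)))"


subsection \<open>Operations on graphs\<close>

definition complete_graph :: "nat \<Rightarrow> nat ugraph"  ("\<K>") where
  "\<K> n = \<lparr>verts = {..<n}, edges = all_pairs {..<n}\<rparr>"

definition graph_compl :: "'a ugraph \<Rightarrow> 'a ugraph" where
  "graph_compl G = \<lparr>verts = verts G, edges = all_pairs (verts G) - edges G\<rparr>"

definition disj_union :: "'a ugraph \<Rightarrow> 'b ugraph \<Rightarrow> ('a + 'b) ugraph"  (infixr "\<oplus>" 65) where
  "G \<oplus> H = \<lparr>verts = verts G <+> verts H,
            edges = (\<lambda>e. Inl ` e) ` edges G \<union> (\<lambda>e. Inr ` e) ` edges H\<rparr>"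

definition graph_join :: "'a ugraph \<Rightarrow> 'b ugraph \<Rightarrow> ('a + 'b) ugraph"  (infixr "\<nabla>" 60) where
  "G \<nabla> H = \<lparr>verts = verts (G \<oplus> H),
            edges = edges (G \<oplus> H) \<union> {{Inl u, Inr v} | u v. u \<in> verts G \<and> v \<in> verts H}\<rparr>"

definition delete_edges :: "'a ugraph \<Rightarrow> 'a set set \<Rightarrow> 'a ugraph" where
  "delete_edges G D = \<lparr>verts = verts G, edges = edges G - D\<rparr>"

definition delete_verts :: "'a ugraph \<Rightarrow> 'a set \<Rightarrow> 'a ugraph" where
  "delete_verts G S = \<lparr>verts = verts G - S, edges = {e \<in> edges G. e \<inter> S = {}}\<rparr>"


subsection \<open>Connectivity and hamiltonicity\<close>

text \<open>The graph without vertices counts as connected, so deleting all vertices is not a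
  vertex cut.\<close>

definition connected_graph :: "'a ugraph \<Rightarrow> bool" where
  "connected_graph G \<longleftrightarrow> (\<forall>u \<in> verts G. \<forall>v \<in> verts G. (adj G)\<^sup>*\<^sup>* u v)"

definition vertex_cut :: "'a ugraph \<Rightarrow> 'a set \<Rightarrow> bool" where
  "vertex_cut G S \<longleftrightarrow> S \<subseteq> verts G \<and> \<not> connected_graph (delete_verts G S)"

text \<open>Complete graphs have no vertex cut; every other simple graph has one.\<close>

definition connectivity :: "'a ugraph \<Rightarrow> nat" where
  "connectivity G =
     (if edges G = all_pairs (verts G) then graph_order G - 1
      else Min {card S | S. vertex_cut G S})"

definition is_cycle :: "'a ugraph \<Rightarrow> 'a list \<Rightarrow> bool" where
  "is_cycle G xs \<longleftrightarrow> 3 \<le> length xs \<and> distinct xs \<and> set xs \<subseteq> verts G \<and>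
     (\<forall>i < length xs. adj G (xs ! i) (xs ! (Suc i mod length xs)))"

definition hamiltonian :: "'a ugraph \<Rightarrow> bool" where
  "hamiltonian G \<longleftrightarrow> (\<exists>xs. is_cycle G xs \<and> set xs = verts G)"


subsection \<open>The extremal function and the extremal graphs\<close>

definition nonham_graph :: "nat \<Rightarrow> nat \<Rightarrow> 'a ugraph \<Rightarrow> bool" where
  "nonham_graph n k G \<longleftrightarrow> simple_graph G \<and> graph_order G = n \<and> connectivity G = k \<and>
     \<not> hamiltonian G"

text \<open>Every finite graph is isomorphic to one whose vertices are natural numbers.\<close>

definition max_nonham_size :: "nat \<Rightarrow> nat \<Rightarrow> nat" where
  "max_nonham_size n k = Max {graph_size G | G :: nat ugraph. nonham_graph n k G}"

definition attains_max :: "nat \<Rightarrow> nat \<Rightarrow> 'a ugraph \<Rightarrow> bool" where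
  "attains_max n k G \<longleftrightarrow> nonham_graph n k G \<and> graph_size G = max_nonham_size n k"

text \<open>In \<open>G\<^sub>1\<close> and \<open>G\<^sub>2\<close> the deleted edges are those joining vertex \<open>0\<close> of the independent part
  to the vertices \<open>k, k + 1, \<dots>\<close> of the complete part. By \<open>G\<^sub>1_unique\<close> and \<open>G\<^sub>2_unique\<close> below, any
  other choice of the same number of edges at one common vertex of the independent part gives an
  isomorphic graph.\<close>

definition G\<^sub>1 :: "nat \<Rightarrow> nat \<Rightarrow> (nat + nat) ugraph" where
  "G\<^sub>1 n k = delete_edges (\<K> ((n - 1) div 2) \<nabla> graph_compl (\<K> ((n + 1) div 2)))
     {{Inl i, Inr 0} | i. k \<le> i \<and> i < (n - 1) div 2}"

definition G\<^sub>2 :: "nat \<Rightarrow> nat \<Rightarrow> (nat + nat + nat) ugraph" where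
  "G\<^sub>2 n k = delete_edges (\<K> ((n - 2) div 2) \<nabla> (\<K> 2 \<oplus> graph_compl (\<K> ((n - 2) div 2))))
     {{Inl i, Inr (Inr 0)} | i. k \<le> i \<and> i < (n - 2) div 2}"


subsection \<open>Independence of the choice of deleted edges\<close>

lemma pair_in_all_pairs: "{a, b} \<in> all_pairs V \<longleftrightarrow> a \<in> V \<and> b \<in> V \<and> a \<noteq> b"
  unfolding all_pairs_def by (auto simp: doubleton_eq_iff)

lemma image_eq_pair_inj:
  assumes "inj h"
  shows "{h a, h b} \<in> (\<lambda>e. h ` e) ` E \<longleftrightarrow> {a, b} \<in> E"
proof -
  have "h ` {a, b} \<in> (\<lambda>e. h ` e) ` E \<longleftrightarrow> {a, b} \<in> E"
    using inj_image_eq_iff[OF assms] by (metis (no_types, lifting) image_iff)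
  then show ?thesis by simp
qed

lemma mixed_not_image:
  "{Inl a, Inr b} \<notin> (\<lambda>e. Inl ` e) ` E" "{Inl a, Inr b} \<notin> (\<lambda>e. Inr ` e) ` F"
  "{Inr b, Inl a} \<notin> (\<lambda>e. Inl ` e) ` E" "{Inr b, Inl a} \<notin> (\<lambda>e. Inr ` e) ` F"
  "{Inl a, Inl c} \<notin> (\<lambda>e. Inr ` e) ` F" "{Inr b, Inr d} \<notin> (\<lambda>e. Inl ` e) ` E"
  by blast+

lemma adj_disj_union:
  "adj (G \<oplus> H) (Inl a) (Inl b) \<longleftrightarrow> adj G a b"
  "adj (G \<oplus> H) (Inr c) (Inr d) \<longleftrightarrow> adj H c d"
  "\<not> adj (G \<oplus> H) (Inl a) (Inr d)"
  "\<not> adj (G \<oplus> H) (Inr d) (Inl a)"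
  by (simp_all add: adj_def disj_union_def mixed_not_image image_eq_pair_inj)

lemma adj_graph_join:
  "adj (G \<nabla> H) (Inl a) (Inl b) \<longleftrightarrow> adj G a b"
  "adj (G \<nabla> H) (Inr c) (Inr d) \<longleftrightarrow> adj H c d"
  "adj (G \<nabla> H) (Inl a) (Inr d) \<longleftrightarrow> a \<in> verts G \<and> d \<in> verts H"
  "adj (G \<nabla> H) (Inr d) (Inl a) \<longleftrightarrow> a \<in> verts G \<and> d \<in> verts H"
  using adj_disj_union[where G = G and H = H]
  by (auto simp: adj_def graph_join_def doubleton_eq_iff)

lemma verts_simps [simp]:
  "verts (\<K> n) = {..<n}" "verts (graph_compl G) = verts G"
  "verts (G \<oplus> H) = verts G <+> verts H" "verts (G \<nabla> H) = verts G <+> verts H"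
  "verts (delete_edges G D) = verts G"
  by (simp_all add: complete_graph_def graph_compl_def disj_union_def graph_join_def delete_edges_def)

lemma adj_complete_graph: "adj (\<K> n) a b \<longleftrightarrow> a < n \<and> b < n \<and> a \<noteq> b"
  by (simp add: adj_def complete_graph_def pair_in_all_pairs)

lemma adj_compl_complete_graph: "\<not> adj (graph_compl (\<K> n)) a b"
  by (simp add: adj_def graph_compl_def complete_graph_def)

lemma adj_delete_edges: "adj (delete_edges G D) u v \<longleftrightarrow> adj G u v \<and> {u, v} \<notin> D"
  by (simp add: adj_def delete_edges_def)

lemma ex_bij_betw_mapping_subset:
  assumes "finite V" "A \<subseteq> V" "B \<subseteq> V" "card A = card B"
  obtains p where "bij_betw p V V" "\<And>x. x \<in> V \<Longrightarrow> p x \<in> B \<longleftrightarrow> x \<in> A"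
proof -
  have fin: "finite A" "finite B" using assms finite_subset by blast+
  obtain g where g: "bij_betw g A B"
    using fin assms(4) finite_same_card_bij by blast
  have "card (V - A) = card (V - B)"
    using assms fin by (simp add: card_Diff_subset)
  then obtain h where h: "bij_betw h (V - A) (V - B)"
    using assms(1) finite_same_card_bij by blast
  define p where "p = (\<lambda>x. if x \<in> A then g x else h x)"
  have pA: "bij_betw p A B"
    using g bij_betw_cong[of A p g B] by (simp add: p_def)
  have pB: "bij_betw p (V - A) (V - B)"
    using h bij_betw_cong[of "V - A" p h "V - B"] by (simp add: p_def)
  have "bij_betw p (A \<union> (V - A)) (B \<union> (V - B))"
    using pA pB by (rule bij_betw_combine) blast
  moreover have "A \<union> (V - A) = V" "B \<union> (V - B) = V" using assms by auto
  ultimately have "bij_betw p V V" by simp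
  moreover have "p x \<in> B \<longleftrightarrow> x \<in> A" if "x \<in> V" for x
    using that bij_betwE[OF pA] bij_betwE[OF pB] by blast
  ultimately show thesis using that by blast
qed

lemma delete_join_iso:
  fixes H :: "'b ugraph"
  assumes q: "bij_betw q (verts H) (verts H)"
    and q_adj: "\<And>x y. x \<in> verts H \<Longrightarrow> y \<in> verts H \<Longrightarrow> adj H (q x) (q y) \<longleftrightarrow> adj H x y"
    and w: "w \<in> verts H" "q w = w0"
    and D: "D \<subseteq> {{Inl i, Inr w} | i. i < m}" "card D = m - k"
  shows "delete_edges (\<K> m \<nabla> H) D
    \<simeq> delete_edges (\<K> m \<nabla> H) {{Inl i, Inr w0} | i. k \<le> i \<and> i < m}"
    (is "_ \<simeq> delete_edges _ ?D0")
proof -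
  define A where "A = {i. i < m \<and> {Inl i, Inr w} \<in> D}"
  have "D = (\<lambda>i. {Inl i, Inr w}) ` A" using D(1) unfolding A_def by auto
  moreover have "inj_on (\<lambda>i. {Inl i, Inr w}) A"
    by (auto simp: inj_on_def doubleton_eq_iff)
  ultimately have "card A = card {k..<m}" using D(2) by (simp add: card_image)
  moreover have "A \<subseteq> {..<m}" "{k..<m} \<subseteq> {..<m}" unfolding A_def by auto
  ultimately obtain p where p: "bij_betw p {..<m} {..<m}"
    and pA: "\<And>i. i \<in> {..<m} \<Longrightarrow> p i \<in> {k..<m} \<longleftrightarrow> i \<in> A"
    using ex_bij_betw_mapping_subset[OF finite_lessThan] by metis
  define f where "f = map_sum p q"
  have p_inj: "p i = p j \<longleftrightarrow> i = j" if "i < m" "j < m" for i j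
    using p that by (metis bij_betw_def inj_on_eq_iff lessThan_iff)
  have p_lt: "p i < m" if "i < m" for i using p that bij_betwE by fastforce
  have q_in: "q x \<in> verts H" if "x \<in> verts H" for x using q that bij_betwE by fastforce
  have q_inj: "q x = w0 \<longleftrightarrow> x = w" if "x \<in> verts H" for x
    using q w that by (metis bij_betw_def inj_on_eq_iff)
  have "f ` (verts (\<K> m) <+> verts H) = (p ` {..<m}) <+> (q ` verts H)"
    by (simp add: f_def Plus_def image_Un image_image)
  then have "f ` (verts (\<K> m) <+> verts H) = verts (\<K> m) <+> verts H"
    using p q by (simp add: bij_betw_def)
  moreover have "inj_on f (verts (\<K> m) <+> verts H)"
  proof (rule inj_onI)
    fix u v assume "u \<in> verts (\<K> m) <+> verts H" "v \<in> verts (\<K> m) <+> verts H" "f u = f v"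
    then show "u = v"
      by (cases u; cases v) (auto simp: f_def p_inj inj_on_eq_iff[OF bij_betw_imp_inj_on[OF q]])
  qed
  ultimately have "bij_betw f (verts (\<K> m) <+> verts H) (verts (\<K> m) <+> verts H)"
    unfolding bij_betw_def by (intro conjI)
  then have bij: "bij_betw f (verts (delete_edges (\<K> m \<nabla> H) D))
      (verts (delete_edges (\<K> m \<nabla> H) ?D0))"
    by (simp only: verts_simps)
  have D_ll: "{Inl i, Inl j} \<notin> D" "{Inr x, Inr y} \<notin> D" for i j x y
    using D(1) by (auto simp: doubleton_eq_iff)
  have D0_ll: "{Inl i, Inl j} \<notin> ?D0" "{Inr x, Inr y} \<notin> ?D0" for i j x y
    by (auto simp: doubleton_eq_iff)
  have D_lr: "{Inl i, Inr x} \<in> D \<longleftrightarrow> i \<in> A \<and> x = w" for i x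
    using D(1) unfolding A_def by (auto simp: doubleton_eq_iff)
  have D0_lr: "{Inl i, Inr x} \<in> ?D0 \<longleftrightarrow> i \<in> {k..<m} \<and> x = w0" for i x
    by (auto simp: doubleton_eq_iff)
  have swap: "{Inr x, Inl i} = {Inl i, Inr x}" for i :: nat and x :: 'b by auto
  have mix: "{Inl (p i), Inr (q x)} \<in> ?D0 \<longleftrightarrow> {Inl i, Inr x} \<in> D" if "i < m" "x \<in> verts H" for i x
    unfolding D_lr D0_lr using pA[of i] q_inj[of x] that by simp
  have "adj (delete_edges (\<K> m \<nabla> H) D) u v \<longleftrightarrow> adj (delete_edges (\<K> m \<nabla> H) ?D0) (f u) (f v)"
    if uv: "u \<in> {..<m} <+> verts H" "v \<in> {..<m} <+> verts H" for u v
  proof (cases u)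
    case u: (Inl i)
    show ?thesis
    proof (cases v)
      case (Inl j)
      then have "i < m" "j < m" using u uv by auto
      then show ?thesis using u Inl p_lt p_inj[of i j] D_ll(1) D0_ll(1)
        unfolding adj_delete_edges f_def
        by (simp add: adj_graph_join adj_complete_graph doubleton_eq_iff)
    next
      case (Inr y)
      then have "i < m" "y \<in> verts H" using u uv by auto
      then show ?thesis using u Inr p_lt q_in mix[of i y]
        unfolding adj_delete_edges f_def by (simp add: adj_graph_join del: mem_Collect_eq)
    qed
  next
    case u: (Inr x)
    show ?thesis
    proof (cases v)
      case (Inl j)
      then have "j < m" "x \<in> verts H" using u uv by auto
      then show ?thesis using u Inl p_lt q_in mix[of j x]
        unfolding adj_delete_edges f_def by (simp add: adj_graph_join swap del: mem_Collect_eq)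
    next
      case (Inr y)
      then have "x \<in> verts H" "y \<in> verts H" using u uv by auto
      then show ?thesis using u Inr D_ll(2) D0_ll(2) q_adj[of x y]
        unfolding adj_delete_edges f_def
        by (simp add: adj_graph_join doubleton_eq_iff)
    qed
  qed
  with bij show ?thesis unfolding graph_iso_def by (intro exI[of _ f]) simp
qed

lemma edges_compl_complete_graph: "edges (graph_compl (\<K> m)) = {}"
  by (simp add: graph_compl_def complete_graph_def)

lemma G\<^sub>1_unique:
  assumes "v < (n + 1) div 2"
    and "D \<subseteq> edges (\<K> ((n - 1) div 2) \<nabla> graph_compl (\<K> ((n + 1) div 2)))"
    and "\<forall>e \<in> D. Inr v \<in> e" and "card D = (n - 1) div 2 - k"
  shows "delete_edges (\<K> ((n - 1) div 2) \<nabla> graph_compl (\<K> ((n + 1) div 2))) D \<simeq> G\<^sub>1 n k"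
  unfolding G\<^sub>1_def
proof (rule delete_join_iso[where q = "id(v := 0, 0 := v)" and w = v])
  show "bij_betw (id(v := 0, 0 := v)) (verts (graph_compl (\<K> ((n + 1) div 2))))
     (verts (graph_compl (\<K> ((n + 1) div 2))))"
    using assms(1) by (intro bij_betw_byWitness[where f' = "id(v := 0, 0 := v)"]) auto
  show "D \<subseteq> {{Inl i, Inr v} | i. i < (n - 1) div 2}"
  proof
    fix e assume "e \<in> D"
    then have "e \<in> edges (\<K> ((n - 1) div 2) \<nabla> graph_compl (\<K> ((n + 1) div 2)))" "Inr v \<in> e"
      using assms(2,3) by auto
    then show "e \<in> {{Inl i, Inr v} | i. i < (n - 1) div 2}"
      by (auto simp: graph_join_def disj_union_def edges_compl_complete_graph)
  qed
qed (use assms(1,4) in \<open>auto simp: adj_compl_complete_graph\<close>)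

lemma G\<^sub>2_unique:
  assumes "v < (n - 2) div 2"
    and "D \<subseteq> edges (\<K> ((n - 2) div 2) \<nabla> (\<K> 2 \<oplus> graph_compl (\<K> ((n - 2) div 2))))"
    and "\<forall>e \<in> D. Inr (Inr v) \<in> e" and "card D = (n - 2) div 2 - k"
  shows "delete_edges (\<K> ((n - 2) div 2) \<nabla> (\<K> 2 \<oplus> graph_compl (\<K> ((n - 2) div 2)))) D
    \<simeq> G\<^sub>2 n k"
  unfolding G\<^sub>2_def
proof (rule delete_join_iso[where q = "map_sum id (id(v := 0, 0 := v))" and w = "Inr v"])
  let ?q = "map_sum id (id(v := 0, 0 := v)) :: nat + nat \<Rightarrow> nat + nat"
  let ?V = "verts (\<K> 2 \<oplus> graph_compl (\<K> ((n - 2) div 2)))"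
  show "bij_betw ?q ?V ?V"
    using assms(1) by (intro bij_betw_byWitness[where f' = ?q]) auto
  show "adj (\<K> 2 \<oplus> graph_compl (\<K> ((n - 2) div 2))) (?q x) (?q y)
    \<longleftrightarrow> adj (\<K> 2 \<oplus> graph_compl (\<K> ((n - 2) div 2))) x y" for x y
    by (cases x; cases y) (simp_all add: adj_disj_union adj_compl_complete_graph)
  show "D \<subseteq> {{Inl i, Inr (Inr v)} | i. i < (n - 2) div 2}"
  proof
    fix e assume "e \<in> D"
    then have "e \<in> edges (\<K> ((n - 2) div 2) \<nabla> (\<K> 2 \<oplus> graph_compl (\<K> ((n - 2) div 2))))"
      "Inr (Inr v) \<in> e"
      using assms(2,3) by auto
    then show "e \<in> {{Inl i, Inr (Inr v)} | i. i < (n - 2) div 2}"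
      by (auto simp: graph_join_def disj_union_def edges_compl_complete_graph)
  qed
qed (use assms(1,4) in auto)

end

(* Close the nonhamiltonian graph G of order n under adding edges as long as it stays nonhamiltonian;
   by Ore's argument nonadjacent vertices of the closure have degree sum below n, and Chvatal's argument
   then yields some i with k <= i < n/2 such that i vertices have degree at most i and n - i vertices have
   degree at most n - 1 - i. The degree sum bounds the size by C(n-i,2) + i^2, and the connectivity saves
   another i - k. If some vertex v has degree k, then v loses i - k and at least i - k of the i
   unrestricted vertices are not adjacent to v. Otherwise a cut of k vertices leaves sides with at
   least two vertices each, so at least i - k of the unrestricted vertices miss two vertices.
   The resulting bound is convex in i, hence maximal at i = k or at the largest i, and
   equality can only occur in the first case, where it determines the graph. *)

theory Submission imports Defs begin

subsection \<open>Degrees and hamiltonian paths\<close>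

text \<open>The closure \<open>H\<close> may have larger connectivity than \<open>G\<close>, so only
  degree bounds are taken from \<open>H\<close>. The cut and the vertex of degree k live in
  \<open>G\<close>, whose degrees are no larger. The saving is counted in the degree sum, where i -
  k edges weigh 2(i - k): one case collects it as (i - k) at \<open>v\<close> plus 1 at each of i -
  k vertices, the other as 2 at each of i - k vertices. One accounting lemma serves both. The
  argument excluding equality in the second case needs k >= 2. For k = 1 it is replaced by a
  comparison of values: the bound at any i > 1 lies below the bound at i = 1. The thresholds come
  from the difference of the bounds at i and j, which is (i - j)(3i + 3j - 2n - 1)/2. With j = k and
  i the largest admissible value, twice the second factor is 6k - 5 - n for odd n and 6k - 8 - n for
  even n. All extremal graphs are described by one adjacency rule, \<open>4 \<le> c x + c y\<close>,
  and five class sizes. Size, connectivity, nonhamiltonicity and isomorphism are therefore settled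
  once for all of them.\<close>

definition nbrs :: "'a ugraph \<Rightarrow> 'a \<Rightarrow> 'a set" where
  "nbrs G v = {w. adj G v w}"

definition deg :: "'a ugraph \<Rightarrow> 'a \<Rightarrow> nat" where
  "deg G v = card (nbrs G v)"

lemma adj_sym: "adj G u v \<Longrightarrow> adj G v u"
  by (simp add: adj_def insert_commute)

lemma simple_adjD:
  assumes "simple_graph G" "adj G u v"
  shows "u \<in> verts G" "v \<in> verts G" "u \<noteq> v"
  using assms subsetD[of "edges G" "all_pairs (verts G)" "{u, v}"]
  by (auto simp: simple_graph_def adj_def pair_in_all_pairs)

lemma simple_finite_verts: "simple_graph G \<Longrightarrow> finite (verts G)"
  by (simp add: simple_graph_def)

lemma nbrs_subset: "simple_graph G \<Longrightarrow> nbrs G v \<subseteq> verts G - {v}"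
  using simple_adjD by (fastforce simp: nbrs_def)

lemma finite_nbrs: "simple_graph G \<Longrightarrow> finite (nbrs G v)"
  using nbrs_subset simple_finite_verts by (metis finite_Diff finite_subset)

lemma finite_edges: "simple_graph G \<Longrightarrow> finite (edges G)"
  unfolding simple_graph_def
  by (rule finite_subset[of _ "Pow (verts G)"]) (auto simp: all_pairs_def)

lemma handshake:
  assumes "simple_graph G"
  shows "(\<Sum>v\<in>verts G. deg G v) = 2 * graph_size G"
proof -
  have *: "card {e \<in> edges G. v \<in> e} = deg G v" if "v \<in> verts G" for v
  proof -
    have "{e \<in> edges G. v \<in> e} = (\<lambda>w. {v, w}) ` nbrs G v"
      using assms by (fastforce simp: nbrs_def adj_def simple_graph_def all_pairs_def insert_commute)
    moreover have "inj_on (\<lambda>w. {v, w}) (nbrs G v)"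
      by (auto simp: inj_on_def doubleton_eq_iff)
    ultimately show ?thesis by (simp add: deg_def card_image)
  qed
  have "(\<Sum>v\<in>verts G. card {e \<in> edges G. v \<in> e}) = 2 * card (edges G)"
  proof (rule sum_multicount)
    show "\<forall>e\<in>edges G. card {v \<in> verts G. v \<in> e} = 2"
    proof
      fix e assume "e \<in> edges G"
      then obtain u v where "e = {u, v}" "u \<in> verts G" "v \<in> verts G" "u \<noteq> v"
        using assms by (auto simp: simple_graph_def all_pairs_def)
      moreover from this have "{v \<in> verts G. v \<in> e} = {u, v}" by auto
      ultimately show "card {v \<in> verts G. v \<in> e} = 2" by simp
    qed
  qed (use assms simple_finite_verts finite_edges in auto)
  with * show ?thesis by (simp add: graph_size_def)
qed

text \<open>Splitting the cycle into a path and a closing edge makes cutting, reversing and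
  concatenating lists available.\<close>

lemma hamiltonian_iff_successively:
  "hamiltonian G \<longleftrightarrow> (\<exists>xs. 3 \<le> length xs \<and> distinct xs \<and> set xs = verts G \<and>
     successively (adj G) xs \<and> adj G (last xs) (hd xs))"
proof -
  have "(\<forall>i < length xs. adj G (xs ! i) (xs ! (Suc i mod length xs))) \<longleftrightarrow>
    successively (adj G) xs \<and> adj G (last xs) (hd xs)" (is "?l \<longleftrightarrow> ?r") if "3 \<le> length xs" for xs
  proof
    assume l: ?l
    have "adj G (xs ! i) (xs ! Suc i)" if "Suc i < length xs" for i
      using l[rule_format, of i] that by simp
    moreover have "adj G (last xs) (hd xs)"
      using l[rule_format, of "length xs - 1"] that by (cases xs) (auto simp: last_conv_nth)
    ultimately show ?r by (simp add: successively_conv_nth)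
  next
    assume r: ?r
    show ?l
    proof (intro allI impI)
      fix i assume i: "i < length xs"
      have "xs \<noteq> []" using that by auto
      show "adj G (xs ! i) (xs ! (Suc i mod length xs))"
      proof (cases "Suc i < length xs")
        case True then show ?thesis using r by (simp add: successively_conv_nth)
      next
        case False
        then have "Suc i = length xs" using i by simp
        then show ?thesis using r \<open>xs \<noteq> []\<close>
          by (auto simp: last_conv_nth hd_conv_nth simp flip: \<open>Suc i = length xs\<close>)
      qed
    qed
  qed
  then show ?thesis unfolding hamiltonian_def is_cycle_def by blast
qed

text \<open>Neighbours of the two ends become path indices below \<open>n - 1\<close>: a neighbour
  of the first vertex is recorded by its predecessor (\<open>I\<close>), a neighbour of the last
  vertex by its own position (\<open>J\<close>). Disjointness of \<open>I\<close> and
  \<open>J\<close> then bounds the degree sum by \<open>n - 1\<close>.\<close>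

lemma ham_path_deg_sum:
  assumes G: "simple_graph G" "\<not> hamiltonian G"
    and xs: "3 \<le> length xs" "distinct xs" "set xs = verts G" "successively (adj G) xs"
  shows "deg G (hd xs) + deg G (last xs) < length xs"
proof -
  define p q n where "p = hd xs" and "q = last xs" and "n = length xs"
  have ne: "xs \<noteq> []" and n: "n \<ge> 3" using xs(1) by (auto simp: n_def)
  have p: "p = xs ! 0" and q: "q = xs ! (n - 1)"
    using ne by (auto simp: p_def q_def n_def hd_conv_nth last_conv_nth)
  define I where "I = {j. Suc j < n \<and> adj G p (xs ! Suc j)}"
  define J where "J = {j. Suc j < n \<and> adj G q (xs ! j)}"
  have mem: "\<exists>j<n. x = xs ! j" if "x \<in> verts G" for x
    using that xs(3) unfolding n_def by (metis in_set_conv_nth)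
  have I: "card I = deg G p"
  proof -
    have "(\<lambda>j. xs ! Suc j) ` I = nbrs G p"
    proof (intro equalityI subsetI)
      fix w assume w: "w \<in> nbrs G p"
      then obtain j where j: "j < n" "w = xs ! j"
        using mem simple_adjD[OF G(1)] unfolding nbrs_def by blast
      have "w \<noteq> p" using w simple_adjD(3)[OF G(1), of p w] by (auto simp: nbrs_def)
      then have "j \<noteq> 0" using j p by metis
      then obtain j' where "j = Suc j'" using not0_implies_Suc by blast
      then show "w \<in> (\<lambda>j. xs ! Suc j) ` I" using w j by (auto simp: I_def nbrs_def)
    qed (auto simp: I_def nbrs_def)
    moreover have "inj_on (\<lambda>j. xs ! Suc j) I"
      using xs(2) by (auto simp: inj_on_def I_def n_def nth_eq_iff_index_eq)
    ultimately show ?thesis by (metis card_image deg_def)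
  qed
  have J: "card J = deg G q"
  proof -
    have "(\<lambda>j. xs ! j) ` J = nbrs G q"
    proof (intro equalityI subsetI)
      fix w assume w: "w \<in> nbrs G q"
      then obtain j where j: "j < n" "w = xs ! j"
        using mem simple_adjD[OF G(1)] unfolding nbrs_def by blast
      have "j \<noteq> n - 1" using w j simple_adjD(3)[OF G(1), of q w] q by (auto simp: nbrs_def)
      then have "Suc j < n" using j by simp
      then show "w \<in> (\<lambda>j. xs ! j) ` J" using w j by (auto simp: J_def nbrs_def)
    qed (auto simp: J_def nbrs_def)
    moreover have "inj_on (\<lambda>j. xs ! j) J"
      using xs(2) by (auto simp: inj_on_def J_def n_def nth_eq_iff_index_eq)
    ultimately show ?thesis by (metis card_image deg_def)
  qed
  \<comment> \<open>An index in both sets would let us reverse the tail of the path and close it to a cycle.\<close>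
  have disj: "I \<inter> J = {}"
  proof (rule ccontr)
    assume "I \<inter> J \<noteq> {}"
    then obtain j where j: "Suc j < n" "adj G p (xs ! Suc j)" "adj G q (xs ! j)"
      by (auto simp: I_def J_def)
    let ?a = "take (Suc j) xs" and ?b = "drop (Suc j) xs"
    have ab: "?a \<noteq> []" "?b \<noteq> []" using ne j by (auto simp: n_def)
    have succ: "successively (adj G) ?a" "successively (adj G) ?b"
      using xs(4) by (metis append_take_drop_id successively_append_iff)+
    have "successively (adj G) (rev ?b)"
      unfolding successively_rev
      by (rule successively_mono[OF succ(2)]) (auto intro: adj_sym)
    moreover have "last ?a = xs ! j" using j by (simp add: take_Suc_conv_app_nth n_def)
    moreover have "hd (rev ?b) = q" using ab by (simp add: hd_rev q_def)
    ultimately have "successively (adj G) (?a @ rev ?b)"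
      using succ j(3) by (simp add: successively_append_iff adj_sym)
    moreover have "last (?a @ rev ?b) = xs ! Suc j"
      using ab j by (simp add: last_rev hd_drop_conv_nth n_def)
    moreover have "hd (?a @ rev ?b) = p" using ne by (simp add: p_def)
    moreover have "distinct (?a @ rev ?b)"
      using xs(2) by (metis append_take_drop_id distinct_append distinct_rev set_rev)
    moreover have "set (?a @ rev ?b) = verts G"
      using xs(3) by (metis append_take_drop_id set_append set_rev)
    moreover have "length (?a @ rev ?b) \<ge> 3" using xs(1) by simp
    ultimately have "hamiltonian G"
      unfolding hamiltonian_iff_successively using adj_sym[OF j(2)] by metis
    then show False using G(2) by simp
  qed
  have "I \<union> J \<subseteq> {..<n - 1}" by (auto simp: I_def J_def)
  then have "card (I \<union> J) \<le> n - 1" by (metis card_lessThan card_mono finite_lessThan)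
  moreover from \<open>I \<union> J \<subseteq> {..<n - 1}\<close> have "finite I" "finite J"
    by (meson finite_Un finite_lessThan finite_subset)+
  ultimately have "card I + card J \<le> n - 1" using disj by (simp add: card_Un_disjoint)
  then show ?thesis using n unfolding I J by (simp add: p_def q_def n_def)
qed

definition add_edge :: "'a ugraph \<Rightarrow> 'a \<Rightarrow> 'a \<Rightarrow> 'a ugraph" where
  "add_edge G u v = \<lparr>verts = verts G, edges = insert {u, v} (edges G)\<rparr>"

lemma adj_add_edge: "adj (add_edge G u v) x y \<longleftrightarrow> adj G x y \<or> {x, y} = {u, v}"
  by (auto simp: adj_def add_edge_def)

text \<open>The cycle must use the new edge; removing that edge leaves a hamiltonian path of
  \<open>G\<close> whose ends are \<open>u\<close> and \<open>v\<close>.\<close>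

lemma deg_sum_less_of_add_edge_hamiltonian:
  assumes G: "simple_graph G" "\<not> hamiltonian G" and H: "hamiltonian (add_edge G u v)"
  shows "deg G u + deg G v < graph_order G"
proof -
  obtain ys where ys: "3 \<le> length ys" "distinct ys" "set ys = verts G"
    and cyc: "\<And>i. i < length ys \<Longrightarrow> adj (add_edge G u v) (ys ! i) (ys ! (Suc i mod length ys))"
    using H unfolding hamiltonian_def is_cycle_def by (auto simp: add_edge_def)
  define n where "n = length ys"
  have "\<not> (\<forall>i<length ys. adj G (ys ! i) (ys ! (Suc i mod length ys)))"
    using G(2) ys unfolding hamiltonian_def is_cycle_def by auto
  then obtain j where j: "j < n" "\<not> adj G (ys ! j) (ys ! (Suc j mod n))" by (auto simp: n_def)
  with cyc have uv: "{ys ! j, ys ! (Suc j mod n)} = {u, v}" by (auto simp: adj_add_edge n_def)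
  \<comment> \<open>The rotation moves the edge missing from \<open>G\<close> to the closing
    position, from the last to the first vertex.\<close>
  define xs where "xs = rotate (Suc j) ys"
  have len: "length xs = n" and dist: "distinct xs" and set: "set xs = verts G"
    using ys by (auto simp: xs_def n_def)
  have nth: "xs ! i = ys ! ((Suc j + i) mod n)" if "i < n" for i
    using that by (simp add: xs_def n_def nth_rotate del: rotate_Suc)
  have ne: "xs \<noteq> []" and n3: "n \<ge> 3" using ys(1) len by (auto simp: n_def)
  have hd: "hd xs = ys ! (Suc j mod n)" using nth[of 0] ne n3 by (simp add: hd_conv_nth)
  have "(Suc j + (n - 1)) mod n = j" using j n3 by simp
  then have last: "last xs = ys ! j" using nth[of "n - 1"] ne n3 by (simp add: last_conv_nth len)
  have "successively (adj G) xs"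
    unfolding successively_conv_nth
  proof (intro allI impI)
    fix i assume i: "Suc i < length xs"
    have "adj (add_edge G u v) (xs ! i) (xs ! Suc i)"
    proof -
      have "Suc ((Suc j + i) mod n) mod n = (Suc j + Suc i) mod n" by (simp add: mod_Suc_eq)
      moreover have "(Suc j + i) mod n < length ys"
        using n3 unfolding n_def by (intro mod_less_divisor) linarith
      ultimately show ?thesis
        using cyc[of "(Suc j + i) mod n"] nth[of i] nth[of "Suc i"] i len by (simp only: n_def)
    qed
    \<comment> \<open>The new edge already joins the two ends of the list; by distinctness an inner
      step could repeat it only if \<open>n\<close> were 2.\<close>
    moreover have "{xs ! i, xs ! Suc i} \<noteq> {u, v}"
    proof
      assume "{xs ! i, xs ! Suc i} = {u, v}"
      then have "{xs ! i, xs ! Suc i} = {xs ! 0, xs ! (n - 1)}"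
        using uv hd last ne by (metis hd_conv_nth insert_commute last_conv_nth len)
      then have "{i, Suc i} = {0, n - 1}"
        using i len dist n3 by (auto simp: doubleton_eq_iff nth_eq_iff_index_eq)
      then show False using n3 by (auto simp: doubleton_eq_iff)
    qed
    ultimately show "adj G (xs ! i) (xs ! Suc i)" by (auto simp: adj_add_edge)
  qed
  from ham_path_deg_sum[OF G _ dist set this] n3 len
  have "deg G (hd xs) + deg G (last xs) < n" by simp
  moreover have "deg G (hd xs) + deg G (last xs) = deg G u + deg G v"
    using uv unfolding hd last by (auto simp: doubleton_eq_iff)
  moreover have "n = graph_order G"
    using dist set len by (metis distinct_card graph_order_def)
  ultimately show ?thesis by simp
qed

subsection \<open>The degree condition of Chvatal\<close>

text \<open>\<open>H\<close> is a supergraph of maximum size among the nonhamiltonian ones on the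
  same vertices, so each further edge creates a hamiltonian cycle and the degree sum lemma applies
  to its ends.\<close>

lemma ex_nonhamiltonian_closure:
  assumes G: "simple_graph G" "\<not> hamiltonian G"
  obtains H where "simple_graph H" "verts H = verts G" "edges G \<subseteq> edges H" "\<not> hamiltonian H"
    "\<And>u v. u \<in> verts G \<Longrightarrow> v \<in> verts G \<Longrightarrow> u \<noteq> v \<Longrightarrow> \<not> adj H u v \<Longrightarrow>
       deg H u + deg H v < graph_order G"
proof -
  define P where "P H \<longleftrightarrow> simple_graph H \<and> verts H = verts G \<and> edges G \<subseteq> edges H \<and> \<not> hamiltonian H"
    for H :: "'a ugraph"
  have "P G" using G by (simp add: P_def)
  moreover have "\<forall>H. P H \<longrightarrow> graph_size H < Suc (card (Pow (verts G)))"
  proof (intro allI impI)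
    fix H assume "P H"
    then have "edges H \<subseteq> Pow (verts G)" by (auto simp: P_def simple_graph_def all_pairs_def)
    then show "graph_size H < Suc (card (Pow (verts G)))"
      unfolding graph_size_def less_Suc_eq_le
      using simple_finite_verts[OF G(1)] by (intro card_mono) auto
  qed
  ultimately obtain H where H: "P H" and max: "\<And>H'. P H' \<Longrightarrow> graph_size H' \<le> graph_size H"
    using ex_has_greatest_nat[of P G graph_size] by blast
  have "deg H u + deg H v < graph_order G"
    if uv: "u \<in> verts G" "v \<in> verts G" "u \<noteq> v" "\<not> adj H u v" for u v
  proof -
    have fin: "finite (edges H)" using H finite_edges by (auto simp: P_def)
    have "graph_size (add_edge H u v) = Suc (graph_size H)"
      using uv fin by (simp add: graph_size_def add_edge_def adj_def)
    then have "\<not> P (add_edge H u v)" using max by fastforce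
    then have "hamiltonian (add_edge H u v)"
      using H uv by (auto simp: P_def add_edge_def simple_graph_def pair_in_all_pairs)
    then have "deg H u + deg H v < graph_order H"
      using H deg_sum_less_of_add_edge_hamiltonian by (auto simp: P_def)
    then show ?thesis using H by (simp add: P_def graph_order_def)
  qed
  with H show thesis by (intro that[of H]) (simp_all add: P_def)
qed

lemma complete_imp_hamiltonian:
  assumes "finite (verts G)" "3 \<le> graph_order G"
    and "\<And>u v. u \<in> verts G \<Longrightarrow> v \<in> verts G \<Longrightarrow> u \<noteq> v \<Longrightarrow> adj G u v"
  shows "hamiltonian G"
proof -
  obtain xs where xs: "set xs = verts G" "distinct xs"
    using finite_distinct_list[OF assms(1)] by blast
  then have len: "length xs \<ge> 3" using assms(2) by (metis distinct_card graph_order_def)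
  have "successively (adj G) xs"
    unfolding successively_conv_nth
    using xs assms(3) by (metis Suc_lessD n_not_Suc_n nth_eq_iff_index_eq nth_mem)
  moreover have "xs \<noteq> []" using len by auto
  then have "adj G (last xs) (hd xs)"
  proof -
    have "last xs \<noteq> hd xs"
      using \<open>xs \<noteq> []\<close> xs(2) len by (simp add: last_conv_nth hd_conv_nth nth_eq_iff_index_eq)
    then show ?thesis using \<open>xs \<noteq> []\<close> assms(3) xs(1) by (metis hd_in_set last_in_set)
  qed
  ultimately show ?thesis using xs len hamiltonian_iff_successively by blast
qed

lemma card_nonneighbours:
  assumes "simple_graph G" "v \<in> verts G"
  shows "card {w \<in> verts G. w \<noteq> v \<and> \<not> adj G v w} = graph_order G - 1 - deg G v"
proof -
  have "{w \<in> verts G. w \<noteq> v \<and> \<not> adj G v w} = (verts G - {v}) - nbrs G v"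
    by (auto simp: nbrs_def)
  then show ?thesis using assms nbrs_subset[OF assms(1)] finite_nbrs[OF assms(1)]
    by (simp add: card_Diff_subset deg_def graph_order_def simple_finite_verts)
qed

text \<open>Among nonadjacent pairs take one with maximum degree sum, with \<open>u\<close> the end
  of smaller degree. By maximality every nonneighbour of \<open>v\<close> has degree at most
  \<open>deg G u\<close>, and every nonneighbour of \<open>u\<close> has degree at most
  \<open>deg G v\<close>; counting both sets gives the two bounds. The vertex \<open>u\<close> is
  returned because its degree later yields \<open>k \<le> i\<close>.\<close>

lemma chvatal_condition:
  assumes G: "simple_graph G" "\<not> hamiltonian G" "3 \<le> graph_order G"
    and closed: "\<And>u v. u \<in> verts G \<Longrightarrow> v \<in> verts G \<Longrightarrow> u \<noteq> v \<Longrightarrow> \<not> adj G u v \<Longrightarrow>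
       deg G u + deg G v < graph_order G"
  obtains i u where "2 * i < graph_order G" "u \<in> verts G" "deg G u = i"
    "i \<le> card {w \<in> verts G. deg G w \<le> i}"
    "graph_order G - i \<le> card {w \<in> verts G. deg G w \<le> graph_order G - 1 - i}"
proof -
  define n where "n = graph_order G"
  define P where "P = (\<lambda>(u, v). u \<in> verts G \<and> v \<in> verts G \<and> u \<noteq> v \<and> \<not> adj G u v)"
  define f where "f = (\<lambda>(u, v). deg G u + deg G v)"
  have fin: "finite (verts G)" using G simple_finite_verts by blast
  \<comment> \<open>A complete graph on at least three vertices is hamiltonian, so some nonadjacent
    pair exists.\<close>
  obtain e where "P e"
    using complete_imp_hamiltonian[OF fin G(3)] G(2) by (auto simp: P_def)
  moreover have "\<forall>e. P e \<longrightarrow> f e < n" using closed by (auto simp: P_def f_def n_def)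
  ultimately obtain e where e: "P e" "\<And>e'. P e' \<Longrightarrow> f e' \<le> f e"
    using ex_has_greatest_nat[of P e f n] by blast
  obtain u v where uv: "u \<in> verts G" "v \<in> verts G" "u \<noteq> v" "\<not> adj G u v" "deg G u \<le> deg G v"
    and max: "\<And>x y. x \<in> verts G \<Longrightarrow> y \<in> verts G \<Longrightarrow> x \<noteq> y \<Longrightarrow> \<not> adj G x y \<Longrightarrow>
      deg G x + deg G y \<le> deg G u + deg G v"
  proof -
    obtain a b where ab: "e = (a, b)" by (cases e)
    have *: "a \<in> verts G" "b \<in> verts G" "a \<noteq> b" "\<not> adj G a b" using e(1) by (auto simp: ab P_def)
    have **: "deg G x + deg G y \<le> deg G a + deg G b"
      if "x \<in> verts G" "y \<in> verts G" "x \<noteq> y" "\<not> adj G x y" for x y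
      using e(2)[of "(x, y)"] that by (auto simp: P_def f_def ab)
    show thesis
    proof (cases "deg G a \<le> deg G b")
      case True then show thesis using that[of a b] * ** by blast
    next
      case False
      have "\<not> adj G b a" using *(4) adj_sym by metis
      then show thesis using that[of b a] * ** False by (metis add.commute nat_le_linear)
    qed
  qed
  define i where "i = deg G u"
  have sum: "i + deg G v < n" using closed uv by (simp add: n_def i_def)
  have "{w \<in> verts G. w \<noteq> v \<and> \<not> adj G v w} \<subseteq> {w \<in> verts G. deg G w \<le> i}"
    using max uv by (fastforce simp: i_def)
  then have "card {w \<in> verts G. w \<noteq> v \<and> \<not> adj G v w} \<le> card {w \<in> verts G. deg G w \<le> i}"
    using fin by (intro card_mono) auto
  then have "n - 1 - deg G v \<le> card {w \<in> verts G. deg G w \<le> i}"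
    unfolding card_nonneighbours[OF G(1) uv(2)] n_def .
  then have 1: "i \<le> card {w \<in> verts G. deg G w \<le> i}" using sum by linarith
  have "deg G w \<le> deg G v" if "w \<in> verts G" "w \<noteq> u" "\<not> adj G u w" for w
    using max[of u w] uv that by auto
  then have "insert u {w \<in> verts G. w \<noteq> u \<and> \<not> adj G u w} \<subseteq> {w \<in> verts G. deg G w \<le> n - 1 - i}"
    using uv sum by (fastforce simp: i_def)
  then have "card (insert u {w \<in> verts G. w \<noteq> u \<and> \<not> adj G u w})
      \<le> card {w \<in> verts G. deg G w \<le> n - 1 - i}"
    using fin by (intro card_mono) auto
  moreover have "card (insert u {w \<in> verts G. w \<noteq> u \<and> \<not> adj G u w}) = n - i"
    using fin card_nonneighbours[OF G(1) uv(1)] sum by (auto simp: n_def i_def)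
  ultimately have 2: "n - i \<le> card {w \<in> verts G. deg G w \<le> n - 1 - i}" by simp
  show thesis
  proof (rule that)
    show "2 * i < graph_order G" using sum uv(5) by (simp add: n_def i_def)
  qed (use 1 2 uv(1) in \<open>simp_all add: n_def i_def\<close>)
qed

subsection \<open>Vertex cuts\<close>

lemma connectivity_le_cut:
  assumes "simple_graph G" "vertex_cut G S"
  shows "connectivity G \<le> card S"
proof -
  have fin: "finite {card S | S. vertex_cut G S}"
    using simple_finite_verts[OF assms(1)]
    by (intro finite_subset[OF _ finite_imageI[of "Pow (verts G)" card]]) (auto simp: vertex_cut_def)
  show ?thesis
  proof (cases "edges G = all_pairs (verts G)")
    case True
    define H where "H = delete_verts G S"
    have "connected_graph H"
      unfolding connected_graph_def
    proof (intro ballI)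
      fix u v assume "u \<in> verts H" "v \<in> verts H"
      then have "u = v \<or> adj H u v"
        using True by (auto simp: H_def delete_verts_def adj_def pair_in_all_pairs)
      then show "(adj H)\<^sup>*\<^sup>* u v" by auto
    qed
    then show ?thesis using assms(2) by (simp add: vertex_cut_def H_def)
  next
    case False
    then show ?thesis unfolding connectivity_def using fin assms(2) by (auto intro!: Min_le)
  qed
qed

text \<open>This and the elimination rule below replace reachability by two nonempty sides with no
  edge between them.\<close>

lemma vertex_cutI:
  assumes "simple_graph G" "A \<inter> B = {}" "A \<noteq> {}" "B \<noteq> {}"  "verts G - S = A \<union> B" "S \<subseteq> verts G"
    and "\<And>a b. a \<in> A \<Longrightarrow> b \<in> B \<Longrightarrow> \<not> adj G a b"
  shows "vertex_cut G S"
proof -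
  define H where "H = delete_verts G S"
  obtain a b where ab: "a \<in> A" "b \<in> B" using assms by blast
  have step: "y \<in> A" if "x \<in> A" "adj H x y" for x y
  proof -
    have "adj G x y" "y \<notin> S" using that by (auto simp: H_def delete_verts_def adj_def)
    then show ?thesis using assms(5,7) that(1) simple_adjD[OF assms(1)] by blast
  qed
  have "y \<in> A" if "(adj H)\<^sup>*\<^sup>* a y" for y
    using that by induction (use ab step in auto)
  then have "\<not> (adj H)\<^sup>*\<^sup>* a b" using ab assms(2) by blast
  moreover have "a \<in> verts H" "b \<in> verts H" using ab assms(5) by (auto simp: H_def delete_verts_def)
  ultimately show ?thesis using assms(6) by (auto simp: vertex_cut_def connected_graph_def H_def)
qed

lemma vertex_cutE:
  assumes "simple_graph G" "vertex_cut G S"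
  obtains A B where "A \<inter> B = {}" "A \<noteq> {}" "B \<noteq> {}"  "verts G - S = A \<union> B" "S \<subseteq> verts G"
    "\<And>a b. a \<in> A \<Longrightarrow> b \<in> B \<Longrightarrow> \<not> adj G a b"
proof -
  define H where "H = delete_verts G S"
  have vH: "verts H = verts G - S" by (simp add: H_def delete_verts_def)
  obtain u v where uv: "u \<in> verts H" "v \<in> verts H" "\<not> (adj H)\<^sup>*\<^sup>* u v"
    using assms(2) by (auto simp: vertex_cut_def connected_graph_def H_def)
  define A where "A = {w \<in> verts H. (adj H)\<^sup>*\<^sup>* u w}"
  have "\<not> adj G a b" if "a \<in> A" "b \<in> verts H - A" for a b
  proof
    assume "adj G a b"
    then have "adj H a b" using that by (auto simp: H_def delete_verts_def adj_def A_def)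
    then show False using that by (auto simp: A_def dest: rtranclp.rtrancl_into_rtrancl)
  qed
  then show thesis
    using uv assms(2) by (intro that[of A "verts H - A"]) (auto simp: A_def vH vertex_cut_def)
qed

text \<open>The strict inequality rules out the complete graph, whose connectivity is set by
  convention. Otherwise deleting all but two nonadjacent vertices is a cut, so the minimum is taken
  over a nonempty set and is attained.\<close>

lemma connectivity_cut:
  assumes "simple_graph G" "Suc (connectivity G) < graph_order G"
  obtains S where "vertex_cut G S" "card S = connectivity G"
proof -
  have nc: "edges G \<noteq> all_pairs (verts G)" using assms(2) by (auto simp: connectivity_def)
  then obtain u v where uv: "u \<in> verts G" "v \<in> verts G" "u \<noteq> v" "\<not> adj G u v"
    using assms(1) by (auto simp: simple_graph_def all_pairs_def adj_def)
  have "vertex_cut G (verts G - {u, v})"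
    by (rule vertex_cutI[OF assms(1), of "{u}" "{v}"]) (use uv in auto)
  then have "{card S | S. vertex_cut G S} \<noteq> {}" by blast
  moreover have "finite {card S | S. vertex_cut G S}"
    using simple_finite_verts[OF assms(1)]
    by (intro finite_subset[OF _ finite_imageI[of "Pow (verts G)" card]]) (auto simp: vertex_cut_def)
  ultimately have "Min {card S | S. vertex_cut G S} \<in> {card S | S. vertex_cut G S}" by (rule Min_in[rotated])
  then obtain S where "vertex_cut G S" "card S = Min {card S | S. vertex_cut G S}" by auto
  then show thesis using nc by (intro that) (simp_all add: connectivity_def)
qed

text \<open>The neighbourhood of \<open>v\<close> separates \<open>v\<close> from the rest, and the
  degree hypothesis makes that rest nonempty.\<close>

lemma connectivity_le_deg:
  assumes "simple_graph G" "v \<in> verts G" "Suc (deg G v) < graph_order G"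
  shows "connectivity G \<le> deg G v"
proof -
  have sub: "nbrs G v \<subseteq> verts G - {v}" using nbrs_subset[OF assms(1)] .
  have "card (insert v (nbrs G v)) < card (verts G)"
    using assms sub finite_nbrs[OF assms(1)] by (simp add: deg_def graph_order_def subset_Diff_insert)
  then have "verts G - nbrs G v - {v} \<noteq> {}"
    using card_mono[OF finite.insertI[OF finite_nbrs[OF assms(1)]], of "verts G" v v] by auto
  then have "vertex_cut G (nbrs G v)"
    by (intro vertex_cutI[OF assms(1), of "{v}" "verts G - nbrs G v - {v}"])
      (use assms sub in \<open>auto simp: nbrs_def\<close>)
  then show ?thesis using connectivity_le_cut[OF assms(1)] by (simp add: deg_def)
qed

subsection \<open>The upper bound\<close>

definition extremal_size :: "nat \<Rightarrow> nat \<Rightarrow> nat \<Rightarrow> nat" where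
  "extremal_size n k i = ((n - i) choose 2) + i ^ 2 - (i - k)"

text \<open>All extremal graphs are threshold graphs. Colour 0 is the vertex of degree \<open>k\<close>, colour 1 the rest
  of the independent part, colour 2 the vertices adjacent to everything but that part, colour 4 the
  universal vertices and colour 3 the vertices that miss only the vertex of colour 0. With \<open>i = k\<close> this
  describes \<open>K\<^sub>k \<or> (K\<^bsub>n-2k\<^esub> + K\<^sub>k\<^sup>c)\<close>; with \<open>i = \<lfloor>(n - 1) / 2\<rfloor>\<close> it describes \<open>G\<^sub>1\<close> for odd \<open>n\<close>, where one
  vertex of the independent part gets colour 2, and \<open>G\<^sub>2\<close> for even \<open>n\<close>.\<close>

definition threshold_colouring :: "nat \<Rightarrow> nat \<Rightarrow> nat \<Rightarrow> 'a ugraph \<Rightarrow> ('a \<Rightarrow> nat) \<Rightarrow> bool" where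
  "threshold_colouring n k i G c \<longleftrightarrow>
     (\<forall>x \<in> verts G. c x \<le> 4) \<and>
     card {x \<in> verts G. c x = 0} = 1 \<and> card {x \<in> verts G. c x = 1} = i - 1 \<and>
     card {x \<in> verts G. c x = 2} = n - 2 * i \<and> card {x \<in> verts G. c x = 3} = i - k \<and>
     card {x \<in> verts G. c x = 4} = k \<and>
     (\<forall>x \<in> verts G. \<forall>y \<in> verts G. adj G x y \<longleftrightarrow> x \<noteq> y \<and> 4 \<le> c x + c y)"

text \<open>The right side is the sum of the degree caps: \<open>i\<close> for \<open>i\<close>
  vertices, \<open>n - 1 - i\<close> for \<open>n - 2 * i\<close> vertices and \<open>n - 1\<close>
  for the remaining \<open>i\<close>. The saving stands on the left to avoid truncated
  subtraction.\<close>

lemma twice_extremal_size: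
  assumes "2 * i < n"
  shows "2 * extremal_size n k i + 2 * (i - k) = i * i + (n - 2 * i) * (n - 1 - i) + i * (n - 1)"
proof -
  obtain r where n: "n = 2 * i + 1 + r" using assms less_iff_Suc_add by (metis Suc_eq_plus1 add_Suc)
  have "even ((n - i) * (n - i - 1))" by (cases "n - i") simp_all
  then have "2 * ((n - i) choose 2) = (n - i) * (n - i - 1)" by (simp add: choose_two)
  also have "\<dots> = (i + 1 + r) * (i + r)" using n by simp
  finally have c: "2 * ((n - i) choose 2) = (i + 1 + r) * (i + r)" .
  \<comment> \<open>This makes the subtraction inside \<open>extremal_size\<close> exact.\<close>
  have "i - k \<le> i ^ 2" by (metis diff_le_self le_square order_trans power2_eq_square)
  then have "2 * extremal_size n k i + 2 * (i - k) = 2 * ((n - i) choose 2) + 2 * i ^ 2"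
    by (simp add: extremal_size_def)
  also have "\<dots> = i * i + (n - 2 * i) * (n - 1 - i) + i * (n - 1)"
    unfolding c by (simp add: n algebra_simps power2_eq_square)
  finally show ?thesis .
qed

text \<open>Trims the sets of the degree condition to nested classes of exact size, so that the caps
  have a fixed sum. \<open>A\<close> prescribes vertices that must receive the cap \<open>i\<close>:
  it is the vertex of degree \<open>k\<close> in one case and empty in the other.\<close>

lemma ex_degree_classes:
  fixes d :: "'a \<Rightarrow> nat"
  assumes "finite V" "2 * i < n" "i \<le> card {w \<in> V. d w \<le> i}"
    and "n - i \<le> card {w \<in> V. d w \<le> n - 1 - i}"
    and "A \<subseteq> {w \<in> V. d w \<le> i}" "card A \<le> i"
  obtains L N where "A \<subseteq> L" "L \<subseteq> N" "N \<subseteq> V" "card L = i" "card N = n - i"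
    "\<And>w. w \<in> L \<Longrightarrow> d w \<le> i" "\<And>w. w \<in> N \<Longrightarrow> d w \<le> n - 1 - i"
proof -
  obtain L where L: "A \<subseteq> L" "L \<subseteq> {w \<in> V. d w \<le> i}" "card L = i"
    using exists_subset_between[OF assms(6,3,5)] assms(1) by auto
  have "L \<subseteq> {w \<in> V. d w \<le> n - 1 - i}" using L(2) assms(2) by auto
  moreover have "card L \<le> n - i" using L(3) assms(2) by simp
  ultimately obtain N where "L \<subseteq> N" "N \<subseteq> {w \<in> V. d w \<le> n - 1 - i}" "card N = n - i"
    using exists_subset_between[OF _ assms(4), of L] assms(1) by auto
  then show thesis using L by (intro that[of L N]) auto
qed

text \<open>\<open>\<gamma> x\<close> is a guaranteed shortfall of \<open>x\<close> below its cap.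
  Summing over all vertices and applying the handshake identity gives the bound; equality leaves no
  slack at any vertex, which is what the structural arguments use.\<close>

lemma size_bound_of_deficiency:
  fixes \<gamma> :: "'a \<Rightarrow> nat"
  assumes G: "simple_graph G" "graph_order G = n" "2 * i < n"
    and LN: "L \<subseteq> N" "N \<subseteq> verts G" "card L = i" "card N = n - i"
    and bound: "\<forall>x \<in> verts G.
      deg G x + \<gamma> x \<le> (if x \<in> L then i else if x \<in> N then n - 1 - i else n - 1)"
    and \<gamma>: "2 * (i - k) \<le> (\<Sum>x\<in>verts G. \<gamma> x)"
  shows "graph_size G \<le> extremal_size n k i"
    and "graph_size G = extremal_size n k i \<Longrightarrow> (\<Sum>x\<in>verts G. \<gamma> x) = 2 * (i - k)"
    and "graph_size G = extremal_size n k i \<Longrightarrow> x \<in> verts G \<Longrightarrow>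
      deg G x + \<gamma> x = (if x \<in> L then i else if x \<in> N then n - 1 - i else n - 1)"
proof -
  define \<beta> where "\<beta> x = (if x \<in> L then i else if x \<in> N then n - 1 - i else n - 1)" for x
  have fin: "finite (verts G)" using G(1) simple_finite_verts by blast
  then have finL: "finite N" "finite L" using LN finite_subset by metis+
  have V: "verts G = L \<union> ((N - L) \<union> (verts G - N))" using LN by auto
  have "(\<Sum>x\<in>verts G. \<beta> x) = (\<Sum>x\<in>L. \<beta> x) + ((\<Sum>x\<in>N - L. \<beta> x) + (\<Sum>x\<in>verts G - N. \<beta> x))"
    using fin finL LN(1) by (subst V, subst sum.union_disjoint; (subst sum.union_disjoint)?) auto
  also have "(\<Sum>x\<in>L. \<beta> x) = i * i" using LN(3) by (simp add: \<beta>_def)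
  also have "(\<Sum>x\<in>N - L. \<beta> x) = (n - 2 * i) * (n - 1 - i)"
  proof -
    have "card (N - L) = n - 2 * i" using LN finL by (simp add: card_Diff_subset)
    then show ?thesis by (simp add: \<beta>_def)
  qed
  also have "(\<Sum>x\<in>verts G - N. \<beta> x) = i * (n - 1)"
  proof -
    have "card (verts G - N) = i" using LN finL G by (simp add: card_Diff_subset graph_order_def)
    moreover have "(\<Sum>x\<in>verts G - N. \<beta> x) = (\<Sum>x\<in>verts G - N. n - 1)"
      using LN(1) by (intro sum.cong) (auto simp: \<beta>_def)
    ultimately show ?thesis by simp
  qed
  finally have \<beta>: "(\<Sum>x\<in>verts G. \<beta> x) = 2 * extremal_size n k i + 2 * (i - k)"
    using twice_extremal_size[OF G(3)] by simp
  have le: "deg G x + \<gamma> x \<le> \<beta> x" if "x \<in> verts G" for x using bound that by (simp add: \<beta>_def)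
  have "(\<Sum>x\<in>verts G. deg G x + \<gamma> x) \<le> (\<Sum>x\<in>verts G. \<beta> x)" using le by (rule sum_mono)
  then have main: "2 * graph_size G + (\<Sum>x\<in>verts G. \<gamma> x) \<le> 2 * extremal_size n k i + 2 * (i - k)"
    unfolding \<beta> sum.distrib handshake[OF G(1)] .
  then show "graph_size G \<le> extremal_size n k i" using \<gamma> by linarith
  show eq: "(\<Sum>x\<in>verts G. \<gamma> x) = 2 * (i - k)" if "graph_size G = extremal_size n k i"
    using main \<gamma> that by linarith
  show "deg G x + \<gamma> x = (if x \<in> L then i else if x \<in> N then n - 1 - i else n - 1)"
    if s: "graph_size G = extremal_size n k i" and x: "x \<in> verts G"
  proof -
    have "(\<Sum>x\<in>verts G. deg G x + \<gamma> x) = (\<Sum>x\<in>verts G. \<beta> x)"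
      unfolding \<beta> sum.distrib handshake[OF G(1)] eq[OF s] using s by simp
    from sum_mono_inv[OF this le x fin] show ?thesis by (simp add: \<beta>_def)
  qed
qed

text \<open>In the equality case each neighbourhood is found by an inclusion between sets of equal
  size. The vertices of \<open>T\<close> come before those of \<open>L\<close> and
  \<open>N - L\<close>, whose adjacencies to \<open>T\<close> follow by symmetry.\<close>

lemma size_bound_min_degree_attained:
  assumes G: "simple_graph G" "graph_order G = n" and ki: "1 \<le> k" "k \<le> i" "2 * i < n"
    and low: "i \<le> card {w \<in> verts G. deg G w \<le> i}"
    and mid: "n - i \<le> card {w \<in> verts G. deg G w \<le> n - 1 - i}"
    and v: "v \<in> verts G" "deg G v = k"
  shows "graph_size G \<le> extremal_size n k i"
    and "graph_size G = extremal_size n k i \<Longrightarrow> \<exists>c. threshold_colouring n k i G c"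
proof -
  have fin: "finite (verts G)" using G(1) simple_finite_verts by blast
  obtain L N where LN: "{v} \<subseteq> L" "L \<subseteq> N" "N \<subseteq> verts G" "card L = i" "card N = n - i"
    "\<And>w. w \<in> L \<Longrightarrow> deg G w \<le> i" "\<And>w. w \<in> N \<Longrightarrow> deg G w \<le> n - 1 - i"
    \<comment> \<open>Forcing \<open>v\<close> into \<open>L\<close> gives it the cap
      \<open>i\<close>, so its degree \<open>k\<close> falls short by exactly
      \<open>i - k\<close>.\<close>
    by (rule ex_degree_classes[OF fin ki(3) low mid, of "{v}"]) (use v ki in auto)
  have finN: "finite N" "finite L" using fin LN finite_subset by metis+
  define T where "T = verts G - N"
  have T: "card T = i" "finite T" using LN fin finN G ki by (auto simp: T_def card_Diff_subset graph_order_def)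
  define R where "R = T - nbrs G v"
  have cardR: "i - k \<le> card R"
    using diff_card_le_card_Diff[OF finite_nbrs[OF G(1)], of T v] T v by (simp add: R_def deg_def)
  have vN: "v \<in> N" "v \<in> L" "v \<notin> T" using LN by (auto simp: T_def)
  have nb: "nbrs G x \<subseteq> verts G - {x}" for x using nbrs_subset[OF G(1)] .
  have degV: "deg G x \<le> n - 1" if "x \<in> verts G" for x
    using card_mono[OF _ nb, of x] fin that G by (simp add: deg_def graph_order_def)
  have nbR: "nbrs G x \<subseteq> verts G - {x, v}" if "x \<in> R" for x
    using that nb[of x] by (auto simp: R_def nbrs_def dest: adj_sym)
  have cR: "card (verts G - {x, v}) = n - 2" if "x \<in> R" for x
  proof -
    have "x \<in> verts G" "x \<noteq> v" using that vN by (auto simp: R_def T_def)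
    then show ?thesis using fin v G by (simp add: card_Diff_subset graph_order_def)
  qed
  \<comment> \<open>Each of the at least \<open>i - k\<close> vertices of \<open>T\<close> not adjacent to \<open>v\<close> loses 1 from its degree bound, and
    \<open>v\<close> itself loses \<open>i - k\<close>.\<close>
  define \<gamma> where "\<gamma> x = (if x = v then i - k else if x \<in> R then 1 else 0)" for x
  have bound: "\<forall>x \<in> verts G.
    deg G x + \<gamma> x \<le> (if x \<in> L then i else if x \<in> N then n - 1 - i else n - 1)"
  proof
    fix x assume x: "x \<in> verts G"
    show "deg G x + \<gamma> x \<le> (if x \<in> L then i else if x \<in> N then n - 1 - i else n - 1)"
    proof (cases "x \<in> R")
    case True
    have "x \<notin> N" "x \<noteq> v" using True vN by (auto simp: R_def T_def)
    moreover have "deg G x \<le> n - 2"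
      using card_mono[OF _ nbR[OF True]] cR[OF True] fin by (simp add: deg_def)
    ultimately show ?thesis using True LN(2) ki by (auto simp: \<gamma>_def)
  next
    case False
    then show ?thesis using vN v LN(6,7) degV[OF x] ki by (auto simp: \<gamma>_def)
    qed
  qed
  have "(\<Sum>x\<in>verts G. \<gamma> x) = (\<Sum>x\<in>insert v R. \<gamma> x)"
    using v fin by (intro sum.mono_neutral_right) (auto simp: \<gamma>_def R_def T_def)
  also have "\<dots> = (i - k) + card R"
  proof -
    have "v \<notin> R" "finite R" using vN T by (auto simp: R_def)
    moreover have "(\<Sum>x\<in>R. \<gamma> x) = (\<Sum>x\<in>R. 1)"
      using \<open>v \<notin> R\<close> by (intro sum.cong) (auto simp: \<gamma>_def)
    ultimately show ?thesis by (simp add: \<gamma>_def)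
  qed
  finally have sum\<gamma>: "(\<Sum>x\<in>verts G. \<gamma> x) = (i - k) + card R" .
  then have "2 * (i - k) \<le> (\<Sum>x\<in>verts G. \<gamma> x)" using cardR by simp
  note * = size_bound_of_deficiency[OF G ki(3) LN(2-5) bound this]
  show "graph_size G \<le> extremal_size n k i" by (rule *)
  assume eq: "graph_size G = extremal_size n k i"
  have cR': "card R = i - k" using *(2)[OF eq] sum\<gamma> by simp
  note degs = *(3)[OF eq]
  have RT: "R \<subseteq> T" "finite R" using T by (auto simp: R_def)
  have nb_v: "nbrs G v = T - R"
  proof -
    have "card (T - R) = card (nbrs G v)"
      using cR' RT T ki v by (simp add: card_Diff_subset deg_def)
    moreover have "T - R \<subseteq> nbrs G v" by (auto simp: R_def)
    ultimately show ?thesis using card_subset_eq[OF finite_nbrs[OF G(1)]] by metis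
  qed
  have nb_TR: "nbrs G x = verts G - {x}" if "x \<in> T - R" for x
  proof -
    have "x \<in> verts G" "x \<notin> N" "x \<noteq> v" using that vN by (auto simp: T_def)
    then have "card (nbrs G x) = card (verts G - {x})"
      using degs[of x] that fin G LN(2) by (auto simp: \<gamma>_def deg_def graph_order_def)
    then show ?thesis using card_subset_eq[OF _ nb] fin by blast
  qed
  have nb_R: "nbrs G x = verts G - {x, v}" if "x \<in> R" for x
  proof -
    have "x \<in> verts G" "x \<notin> N" "x \<noteq> v" using that vN RT by (auto simp: T_def)
    moreover from this have "x \<notin> L" using LN(2) by blast
    ultimately have "card (nbrs G x) = card (verts G - {x, v})"
      using degs[of x] that cR[OF that] by (simp add: \<gamma>_def deg_def)
    then show ?thesis using card_subset_eq[OF _ nbR[OF that]] fin by blast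
  qed
  \<comment> \<open>All of \<open>T\<close> is already known to be adjacent to \<open>x\<close>, and
    tightness leaves \<open>x\<close> exactly \<open>i = card T\<close> neighbours.\<close>
  have nb_L: "nbrs G x = T" if "x \<in> L" "x \<noteq> v" for x
  proof -
    have x: "x \<in> verts G" "x \<notin> T" using that LN by (auto simp: T_def)
    have "t \<in> nbrs G x" if "t \<in> T" for t
    proof -
      have "x \<in> nbrs G t" using nb_TR[of t] nb_R[of t] x \<open>x \<noteq> v\<close> that by (cases "t \<in> R") auto
      then show ?thesis by (auto simp: nbrs_def dest: adj_sym)
    qed
    moreover have "card (nbrs G x) = card T"
      using degs[of x] x that RT T by (auto simp: \<gamma>_def deg_def split: if_splits)
    ultimately show ?thesis using card_subset_eq[OF finite_nbrs[OF G(1)], of T x] by auto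
  qed
  \<comment> \<open>The vertices of \<open>L\<close> have all their neighbours in \<open>T\<close>,
    so \<open>x\<close> has none in \<open>L\<close>; its tight degree \<open>n - 1 - i\<close>
    exhausts the rest.\<close>
  have nb_N: "nbrs G x = verts G - L - {x}" if "x \<in> N - L" for x
  proof -
    have x: "x \<in> verts G" "x \<notin> T" "x \<noteq> v" using that LN vN by (auto simp: T_def)
    have "y \<notin> nbrs G x" if "y \<in> L" for y
    proof
      assume "y \<in> nbrs G x"
      then have "x \<in> nbrs G y" by (auto simp: nbrs_def dest: adj_sym)
      then show False using nb_v nb_L[of y] that x by (cases "y = v") auto
    qed
    then have "nbrs G x \<subseteq> verts G - L - {x}" using nb[of x] by auto
    moreover have "x \<notin> R" using x RT by blast
    then have "card (nbrs G x) = card (verts G - L - {x})"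
      using degs[of x] x that fin finN LN G by (auto simp: \<gamma>_def deg_def card_Diff_subset graph_order_def)
    ultimately show ?thesis using card_subset_eq fin by (metis finite_Diff)
  qed
  define c :: "'a \<Rightarrow> nat" where
    "c x = (if x = v then 0 else if x \<in> L then 1 else if x \<in> N then 2 else if x \<in> R then 3 else 4)" for x
  have "{x \<in> verts G. c x = 0} = {v}" "{x \<in> verts G. c x = 1} = L - {v}"
    "{x \<in> verts G. c x = 2} = N - L" "{x \<in> verts G. c x = 3} = R" "{x \<in> verts G. c x = 4} = T - R"
    using v LN vN RT by (auto simp: c_def T_def split: if_splits)
  then have "card {x \<in> verts G. c x = 0} = 1" "card {x \<in> verts G. c x = 1} = i - 1"
    "card {x \<in> verts G. c x = 2} = n - 2 * i" "card {x \<in> verts G. c x = 3} = i - k"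
    "card {x \<in> verts G. c x = 4} = k"
    using LN vN finN cR' RT T ki by (simp_all add: card_Diff_subset)
  moreover have "adj G x y \<longleftrightarrow> x \<noteq> y \<and> 4 \<le> c x + c y" if xy: "x \<in> verts G" "y \<in> verts G" for x y
  proof -
    have "adj G x y \<longleftrightarrow> y \<in> nbrs G x" by (simp add: nbrs_def)
    moreover consider "x = v" | "x \<in> L" "x \<noteq> v" | "x \<in> N - L" | "x \<in> R" | "x \<in> T - R"
      using xy by (auto simp: T_def)
    ultimately show ?thesis
      by cases (use xy vN LN(2) RT nb_v nb_L nb_N nb_R nb_TR in \<open>auto simp: c_def T_def\<close>)
  qed
  ultimately show "\<exists>c. threshold_colouring n k i G c"
    by (intro exI[of _ c]) (simp add: threshold_colouring_def c_def)
qed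

lemma deg_mono:
  assumes "simple_graph H" "edges G \<subseteq> edges H"
  shows "nbrs G x \<subseteq> nbrs H x" "deg G x \<le> deg H x"
proof -
  show "nbrs G x \<subseteq> nbrs H x" using assms(2) by (auto simp: nbrs_def adj_def)
  then show "deg G x \<le> deg H x" unfolding deg_def by (intro card_mono finite_nbrs assms)
qed

text \<open>The caps are read off from degrees in \<open>H\<close>, the shortfalls from the cut in
  \<open>G\<close>. The degree sum condition of \<open>H\<close> serves to exclude equality.\<close>

lemma size_bound_min_degree_large:
  assumes G: "simple_graph G" "graph_order G = n"
    and H: "simple_graph H" "verts H = verts G" "edges G \<subseteq> edges H"
    and closed: "\<And>u v. u \<in> verts G \<Longrightarrow> v \<in> verts G \<Longrightarrow> u \<noteq> v \<Longrightarrow> \<not> adj H u v \<Longrightarrow> deg H u + deg H v < n"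
    and ki: "k < i" "2 * i < n"
    and low: "i \<le> card {w \<in> verts G. deg H w \<le> i}"
    and mid: "n - i \<le> card {w \<in> verts G. deg H w \<le> n - 1 - i}"
    and large: "\<And>x. x \<in> verts G \<Longrightarrow> k < deg G x"
    and cut: "vertex_cut G S" "card S = k"
  shows "graph_size G \<le> extremal_size n k i"
    and "2 \<le> k \<Longrightarrow> graph_size G < extremal_size n k i"
proof -
  have fin: "finite (verts G)" using G(1) simple_finite_verts by blast
  obtain A B where AB: "A \<inter> B = {}" "A \<noteq> {}" "B \<noteq> {}" "verts G - S = A \<union> B" "S \<subseteq> verts G"
    "\<And>a b. a \<in> A \<Longrightarrow> b \<in> B \<Longrightarrow> \<not> adj G a b" "card A \<le> card B"
  proof -
    obtain A B where *: "A \<inter> B = {}" "A \<noteq> {}" "B \<noteq> {}" "verts G - S = A \<union> B" "S \<subseteq> verts G"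
      "\<And>a b. a \<in> A \<Longrightarrow> b \<in> B \<Longrightarrow> \<not> adj G a b"
      using vertex_cutE[OF G(1) cut(1)] by metis
    show thesis
    proof (cases "card A \<le> card B")
      case True then show thesis using that[of A B] * by blast
    next
      case False
      then show thesis using *
        by (intro that[of B A]) (auto dest: adj_sym)
    qed
  qed
  have sub: "A \<subseteq> verts G" "B \<subseteq> verts G" "A \<inter> S = {}" "B \<inter> S = {}" using AB(4) by auto
  have fins: "finite A" "finite B" "finite S" using fin sub AB(5) finite_subset by metis+
  have deg_le: "deg G x + card Y \<le> n - 1"
    if "x \<in> X" "X \<inter> Y = {}" "X \<subseteq> verts G" "Y \<subseteq> verts G" "\<And>y. y \<in> Y \<Longrightarrow> \<not> adj G x y" for x X Y
  proof -
    have "nbrs G x \<union> Y \<subseteq> verts G - {x}" using that nbrs_subset[OF G(1), of x] by auto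
    then have "card (nbrs G x \<union> Y) \<le> n - 1"
      using card_mono[of "verts G - {x}"] fin that G by (auto simp: graph_order_def)
    moreover have "nbrs G x \<inter> Y = {}" using that by (auto simp: nbrs_def)
    ultimately show ?thesis
      using card_Un_disjoint[OF finite_nbrs[OF G(1)], of Y x] fin that(4) finite_subset
      by (metis deg_def)
  qed
  have degA: "deg G x + card B \<le> n - 1" if "x \<in> A" for x
    using deg_le[of x A B] that AB sub by blast
  have degB: "deg G x + card A \<le> n - 1" if "x \<in> B" for x
    using deg_le[of x B A] that AB sub adj_sym by (metis Int_commute)
  have cards: "card A + card B + k = n"
  proof -
    have "card (verts G - S) = card A + card B" using AB(1,4) fins by (simp add: card_Un_disjoint)
    then show ?thesis using AB(5) fins cut G card_mono[OF fin AB(5)]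
      by (simp add: card_Diff_subset graph_order_def)
  qed
  \<comment> \<open>A vertex of \<open>A\<close> has all its neighbours among the \<open>k\<close>
    cut vertices and the rest of \<open>A\<close>; degree above \<open>k\<close> forces a second
    vertex there.\<close>
  have A2: "2 \<le> card A"
  proof -
    obtain x where x: "x \<in> A" using AB by blast
    then have "k < deg G x" using large sub by blast
    then show ?thesis using degA[OF x] cards by linarith
  qed
  obtain L N where LN: "{} \<subseteq> L" "L \<subseteq> N" "N \<subseteq> verts G" "card L = i" "card N = n - i"
    "\<And>w. w \<in> L \<Longrightarrow> deg H w \<le> i" "\<And>w. w \<in> N \<Longrightarrow> deg H w \<le> n - 1 - i"
    by (rule ex_degree_classes[OF fin ki(2) low mid, of "{}"]) auto
  have finN: "finite N" "finite L" using fin LN finite_subset by metis+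
  define T where "T = verts G - N"
  have T: "card T = i" "finite T" using LN fin finN G ki by (auto simp: T_def card_Diff_subset graph_order_def)
  have cardTS: "i - k \<le> card (T - S)"
    using diff_card_le_card_Diff[OF fins(3), of T] T cut by simp
  note mono = deg_mono[OF H(1,3)]
  have degV: "deg G x \<le> n - 1" if "x \<in> verts G" for x
    using deg_le[of x "{x}" "{}"] that by simp
  have TSAB: "T - S \<subseteq> A \<union> B" using AB(4) by (auto simp: T_def)
  \<comment> \<open>A vertex of \<open>T - S\<close> misses a whole side of the cut, and both sides have at least 2 vertices.\<close>
  define \<gamma> :: "'a \<Rightarrow> nat" where "\<gamma> x = (if x \<in> T - S then 2 else 0)" for x
  have bound: "\<forall>x \<in> verts G.
    deg G x + \<gamma> x \<le> (if x \<in> L then i else if x \<in> N then n - 1 - i else n - 1)"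
  proof
    fix x assume x: "x \<in> verts G"
    show "deg G x + \<gamma> x \<le> (if x \<in> L then i else if x \<in> N then n - 1 - i else n - 1)"
    proof (cases "x \<in> T - S")
    case True
    then have "deg G x + 2 \<le> n - 1" using TSAB degA[of x] degB[of x] A2 AB(7) by fastforce
    then show ?thesis using True LN(2) by (auto simp: \<gamma>_def T_def)
  next
    case False
    then show ?thesis using LN(6,7)[of x] mono(2)[of x] degV[OF x] by (auto simp: \<gamma>_def)
    qed
  qed
  have "(\<Sum>x\<in>verts G. \<gamma> x) = (\<Sum>x\<in>T - S. \<gamma> x)"
    using fin by (intro sum.mono_neutral_right) (auto simp: \<gamma>_def T_def)
  also have "\<dots> = 2 * card (T - S)" by (simp add: \<gamma>_def)
  finally have "2 * (i - k) \<le> (\<Sum>x\<in>verts G. \<gamma> x)" using cardTS by simp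
  note * = size_bound_of_deficiency[OF G ki(2) LN(2-5) bound this]
  show le: "graph_size G \<le> extremal_size n k i" by (rule *)
  show "graph_size G < extremal_size n k i" if k2: "2 \<le> k"
  proof (rule ccontr)
    assume "\<not> graph_size G < extremal_size n k i"
    then have eq: "graph_size G = extremal_size n k i" using le by simp
    note degs = *(3)[OF eq]
    have "T - S \<noteq> {}" using cardTS ki by (metis card.empty diff_is_0_eq leD le_zero_eq)
    then obtain t where t: "t \<in> T - S" by blast
    \<comment> \<open>Equality makes \<open>x\<close> in \<open>A\<close> and \<open>t\<close> a pair whose degree sum is at least \<open>n\<close>, hence adjacent in the
      closure \<open>H\<close>; but tightness also forces \<open>x\<close> to have the same neighbours in \<open>G\<close> and \<open>H\<close>.\<close>
    have B3: "3 \<le> card B" using cards k2 ki AB(7) by linarith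
    have degT: "deg G x + 2 = n - 1" if "x \<in> T - S" for x
    proof -
      have "x \<in> verts G" "x \<notin> N" "x \<notin> L" using that LN(2) by (auto simp: T_def)
      then show ?thesis using degs[of x] that by (auto simp: \<gamma>_def)
    qed
    \<comment> \<open>Tightness lets a vertex of \<open>T - S\<close> miss exactly two others, but a
      vertex of \<open>A\<close> misses all of \<open>B\<close>, which has at least three vertices
      since \<open>k\<close> is at least 2.\<close>
    have TA: "T \<inter> A = {}"
    proof (rule ccontr)
      assume "T \<inter> A \<noteq> {}"
      then obtain x where "x \<in> A" "x \<in> T - S" using sub by blast
      then show False using degT[of x] degA[of x] B3 by linarith
    qed
    then have tB: "t \<in> B" using t TSAB by blast
    obtain x where x: "x \<in> A" using AB by blast
    have xV: "x \<in> verts G" "x \<in> N" "x \<notin> T" using x sub TA by (auto simp: T_def)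
    have nadj: "\<not> adj G x t" using AB(6) x tB by blast
    have "deg H x \<le> deg G x"
      using degs[OF xV(1)] xV LN(6,7)[of x] by (auto simp: \<gamma>_def split: if_splits)
    then have "nbrs G x = nbrs H x"
      using card_subset_eq[OF finite_nbrs[OF H(1)] mono(1)] mono(2)[of x] by (metis deg_def le_antisym)
    then have "\<not> adj H x t" using nadj by (auto simp: nbrs_def)
    moreover have "x \<noteq> t" "t \<in> verts G" using x tB AB(1) sub by auto
    ultimately have "deg H x + deg H t < n" using closed xV by blast
    then show False
      using mono(2)[of x] mono(2)[of t] large[OF xV(1)] degT[OF t] k2 ki by linarith
  qed
qed

text \<open>The alternative \<open>k = 1 \<and> 1 < i\<close> is what the structural argument leaves
  open; it is excluded later by comparing values of \<open>extremal_size\<close>.\<close>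

lemma nonham_size_bound:
  assumes G: "nonham_graph n k G" and k: "1 \<le> k" "2 * k + 1 \<le> n"
  obtains i where "k \<le> i" "2 * i < n" "graph_size G \<le> extremal_size n k i"
    "graph_size G = extremal_size n k i \<Longrightarrow> (\<exists>c. threshold_colouring n k i G c) \<or> k = 1 \<and> 1 < i"
proof -
  have G': "simple_graph G" "\<not> hamiltonian G" "graph_order G = n" "connectivity G = k"
    using G by (auto simp: nonham_graph_def)
  obtain H where H: "simple_graph H" "verts H = verts G" "edges G \<subseteq> edges H" "\<not> hamiltonian H"
    "\<And>u v. u \<in> verts G \<Longrightarrow> v \<in> verts G \<Longrightarrow> u \<noteq> v \<Longrightarrow> \<not> adj H u v \<Longrightarrow> deg H u + deg H v < n"
    using ex_nonhamiltonian_closure[OF G'(1,2)] G'(3) by metis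
  have ordH: "graph_order H = n" using H(2) G'(3) by (simp add: graph_order_def)
  obtain i u where iu: "2 * i < n" "u \<in> verts G" "deg H u = i"
    "i \<le> card {w \<in> verts G. deg H w \<le> i}" "n - i \<le> card {w \<in> verts G. deg H w \<le> n - 1 - i}"
    by (rule chvatal_condition[OF H(1,4)]) (use H k ordH in auto)
  note mono = deg_mono[OF H(1,3)]
  have fin: "finite (verts G)" using G' simple_finite_verts by blast
  have degk: "k \<le> deg G x" if "x \<in> verts G" for x
    using connectivity_le_deg[OF G'(1) that] G'(3,4) k by linarith
  have ki: "k \<le> i" using degk[OF iu(2)] mono(2)[of u] iu(3) by simp
  show thesis
  proof (cases "\<exists>v\<in>verts G. deg G v = k")
    case True
    then obtain v where v: "v \<in> verts G" "deg G v = k" by blast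
    \<comment> \<open>Degrees only drop from \<open>H\<close> to \<open>G\<close>, so the degree
      condition passes to \<open>G\<close>.\<close>
    have "card {w \<in> verts G. deg H w \<le> j} \<le> card {w \<in> verts G. deg G w \<le> j}" for j
      using mono(2) fin by (intro card_mono) (auto intro: order_trans)
    then have "i \<le> card {w \<in> verts G. deg G w \<le> i}" "n - i \<le> card {w \<in> verts G. deg G w \<le> n - 1 - i}"
      using iu(4,5) order_trans by blast+
    note * = size_bound_min_degree_attained[OF G'(1,3) k(1) ki iu(1) this v]
    show thesis using ki iu(1) * by (intro that[of i]) blast+
  next
    case False
    then have large: "k < deg G x" if "x \<in> verts G" for x using degk that by (metis le_neq_implies_less)
    have ki': "k < i" using large[OF iu(2)] mono(2)[of u] iu(3) by simp
    obtain S where S: "vertex_cut G S" "card S = k"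
      using connectivity_cut[OF G'(1)] G'(3,4) k by auto
    note * = size_bound_min_degree_large[OF G'(1,3) H(1-3,5) ki' iu(1,4,5) large S]
    show thesis
    proof (rule that[OF ki iu(1)])
      show "graph_size G \<le> extremal_size n k i" using * by blast
      show "(\<exists>c. threshold_colouring n k i G c) \<or> k = 1 \<and> 1 < i"
        if "graph_size G = extremal_size n k i"
        using *(2) that k(1) ki' by (cases "k = 1") auto
    qed
  qed
qed

subsection \<open>The extremal graphs\<close>

text \<open>Degrees and class sizes depend on colours alone, so this formula reduces the later
  counts to arithmetic.\<close>

lemma sum_over_colours:
  fixes f :: "nat \<Rightarrow> nat"
  assumes "finite (verts G)" "threshold_colouring n k i G c"
  shows "(\<Sum>x\<in>verts G. f (c x)) =
    f 0 + (i - 1) * f 1 + (n - 2 * i) * f 2 + (i - k) * f 3 + k * f 4"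
proof -
  have "c ` verts G \<subseteq> {0, 1, 2, 3, 4}"
  proof
    fix j assume "j \<in> c ` verts G"
    then have "j \<le> 4" using assms(2) by (auto simp: threshold_colouring_def)
    then show "j \<in> {0, 1, 2, 3, 4}" by auto
  qed
  then have "(\<Sum>x\<in>verts G. f (c x)) = (\<Sum>j\<in>{0, 1, 2, 3, 4}. \<Sum>x\<in>{x \<in> verts G. c x = j}. f (c x))"
    using assms(1) by (intro sum.group[symmetric]) auto
  also have "\<dots> = (\<Sum>j\<in>{0, 1, 2, 3, 4}. card {x \<in> verts G. c x = j} * f j)"
    by (intro sum.cong) simp_all
  finally show ?thesis using assms(2) by (simp add: threshold_colouring_def)
qed

lemma card_over_colours:
  assumes "finite (verts G)" "threshold_colouring n k i G c"
  shows "card {x \<in> verts G. P (c x)} = (if P 0 then 1 else 0) + (i - 1) * (if P 1 then 1 else 0)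
    + (n - 2 * i) * (if P 2 then 1 else 0) + (i - k) * (if P 3 then 1 else 0) + k * (if P 4 then 1 else 0)"
proof -
  have "card {x \<in> verts G. P (c x)} = (\<Sum>x\<in>verts G. if P (c x) then 1 else 0)"
    using assms(1) by (simp add: sum.If_cases Int_def)
  also have "\<dots> = (if P 0 then 1 else 0) + (i - 1) * (if P 1 then 1 else 0)
    + (n - 2 * i) * (if P 2 then 1 else 0) + (i - k) * (if P 3 then 1 else 0) + k * (if P 4 then 1 else 0)"
    by (rule sum_over_colours[OF assms, of "\<lambda>j. if P j then 1 else 0"])
  finally show ?thesis .
qed

section \<open>Invariants of threshold graphs\<close>

context
  fixes G :: "'a ugraph" and n k i c
  assumes G: "simple_graph G" and c: "threshold_colouring n k i G c"
    and ki: "1 \<le> k" "k \<le> i" "2 * i < n"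
begin

lemma finite_verts_threshold: "finite (verts G)"
  using G simple_finite_verts by blast

lemma adj_threshold:
  "x \<in> verts G \<Longrightarrow> y \<in> verts G \<Longrightarrow> adj G x y \<longleftrightarrow> x \<noteq> y \<and> 4 \<le> c x + c y"
  using c by (simp add: threshold_colouring_def)

lemmas card_colours = card_over_colours[OF finite_verts_threshold c]

lemma graph_order_threshold: "graph_order G = n"
  using card_colours[of "\<lambda>_. True"] ki by (simp add: graph_order_def)

text \<open>For colours 2 and above \<open>4 \<le> c x + c x\<close> holds, so the count includes
  \<open>x\<close> itself and must be reduced by one.\<close>

lemma deg_threshold:
  assumes x: "x \<in> verts G"
  shows "deg G x = card {y \<in> verts G. 4 \<le> c x + c y} - (if 2 \<le> c x then 1 else 0)"
proof -
  have "nbrs G x = {y \<in> verts G. 4 \<le> c x + c y} - {x}"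
    using adj_threshold[OF x] simple_adjD(2)[OF G, of x] by (auto simp: nbrs_def)
  then show ?thesis using x finite_verts_threshold by (auto simp: deg_def)
qed

lemma graph_size_threshold: "graph_size G = extremal_size n k i"
proof -
  define f where "f a = card {y \<in> verts G. 4 \<le> a + c y} - (if 2 \<le> a then 1 else 0)" for a
  have f: "f 0 = k" "f 1 = i" "f 2 = n - i - 1" "f 3 = n - 2" "f 4 = n - 1"
    using card_colours[of "\<lambda>b. 4 \<le> 0 + b"] card_colours[of "\<lambda>b. 4 \<le> 1 + b"]
      card_colours[of "\<lambda>b. 4 \<le> 2 + b"] card_colours[of "\<lambda>b. 4 \<le> 3 + b"]
      card_colours[of "\<lambda>b. 4 \<le> 4 + b"] ki
    by (simp_all add: f_def)
  have "2 * graph_size G = (\<Sum>x\<in>verts G. f (c x))"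
    unfolding handshake[OF G, symmetric] by (intro sum.cong) (simp_all add: deg_threshold f_def)
  also have "\<dots> = k + (i - 1) * i + (n - 2 * i) * (n - i - 1) + (i - k) * (n - 2) + k * (n - 1)"
    by (rule sum_over_colours[OF finite_verts_threshold c, of f, unfolded f])
  finally have 1: "2 * graph_size G = \<dots>" .
  \<comment> \<open>Writing the parameters as sums removes every truncated subtraction before the
    ring identity.\<close>
  obtain s where s: "i = k + s" using ki le_Suc_ex by blast
  obtain r where r: "n = 2 * i + 1 + r" using ki less_iff_Suc_add by (metis Suc_eq_plus1 add_Suc)
  obtain k' where k': "k = Suc k'" using ki by (cases k) auto
  have "2 * graph_size G + 2 * (i - k) = i * i + (n - 2 * i) * (n - 1 - i) + i * (n - 1)"
    unfolding 1 by (simp add: s r k' algebra_simps)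
  then show ?thesis using twice_extremal_size[OF ki(3), of k] by simp
qed

text \<open>The vertex of colour 0 gives the upper bound. A smaller cut would leave a universal
  vertex of colour 4, which is adjacent to both sides.\<close>

lemma connectivity_threshold: "connectivity G = k"
proof (rule antisym)
  have "card {x \<in> verts G. c x = 0} = 1" using c by (simp add: threshold_colouring_def)
  then obtain v where v: "v \<in> verts G" "c v = 0"
    by (metis (mono_tags, lifting) card_1_singletonE mem_Collect_eq singletonI)
  have "deg G v = k" using deg_threshold[OF v(1)] v card_colours[of "\<lambda>b. 4 \<le> b"] by simp
  then show le: "connectivity G \<le> k"
    using connectivity_le_deg[OF G v(1)] ki by (simp add: graph_order_threshold)
  show "k \<le> connectivity G"
  proof (rule ccontr)
    assume "\<not> k \<le> connectivity G"
    moreover obtain S where S: "vertex_cut G S" "card S = connectivity G"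
      using connectivity_cut[OF G] le ki by (auto simp: graph_order_threshold)
    ultimately have "card S < k" by simp
    have "card {x \<in> verts G. c x = 4} = k" using c by (simp add: threshold_colouring_def)
    moreover have "finite S"
      using S finite_verts_threshold by (auto simp: vertex_cut_def intro: finite_subset)
    ultimately have "\<not> {x \<in> verts G. c x = 4} \<subseteq> S"
      using \<open>card S < k\<close> card_mono by (metis not_le)
    then obtain w where w: "w \<in> verts G" "c w = 4" "w \<notin> S" by blast
    have adj: "adj G w x" "adj G x w" if "x \<in> verts G" "x \<noteq> w" for x
      using adj_threshold w that by auto
    obtain A B where AB: "A \<inter> B = {}" "A \<noteq> {}" "B \<noteq> {}" "verts G - S = A \<union> B"
      "\<And>a b. a \<in> A \<Longrightarrow> b \<in> B \<Longrightarrow> \<not> adj G a b"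
      using vertex_cutE[OF G S(1)] by metis
    obtain a b where ab: "a \<in> A" "b \<in> B" using AB by blast
    have "w \<in> A \<or> w \<in> B" "a \<in> verts G" "b \<in> verts G" using w AB(4) ab by auto
    then show False using AB(1,5) ab adj by (metis disjoint_iff)
  qed
qed

text \<open>The colours at most 1 and the colours at least 3 form classes of the same size, and every
  neighbour of a vertex in the first class lies in the second. A hamiltonian cycle would therefore
  alternate between them and never reach a vertex of colour 2.\<close>

lemma not_hamiltonian_threshold: "\<not> hamiltonian G"
proof
  assume "hamiltonian G"
  then obtain xs where xs: "3 \<le> length xs" "distinct xs" "set xs = verts G"
    and cyc: "\<And>j. j < length xs \<Longrightarrow> adj G (xs ! j) (xs ! (Suc j mod length xs))"
    unfolding hamiltonian_def is_cycle_def by blast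
  define s where "s j = Suc j mod length xs" for j
  have s: "s j = (if Suc j = length xs then 0 else Suc j)" if "j < length xs" for j
    using that by (auto simp: s_def)
  have inj: "inj_on s {..<length xs}"
    by (rule inj_onI) (auto simp: s split: if_splits)
  have s_lt: "s j < length xs" for j using xs(1) unfolding s_def by (intro mod_less_divisor) linarith
  then have bij: "s ` {..<length xs} = {..<length xs}"
    by (intro endo_inj_surj inj) auto
  define X where "X P = {j. j < length xs \<and> P (c (xs ! j))}" for P
  have cardX: "card (X P) = card {x \<in> verts G. P (c x)}" for P
  proof -
    have "(\<lambda>j. xs ! j) ` X P = {x \<in> verts G. P (c x)}"
      unfolding xs(3)[symmetric] X_def set_conv_nth by blast
    moreover have "inj_on (\<lambda>j. xs ! j) (X P)"
      using xs(2) by (auto simp: inj_on_def X_def nth_eq_iff_index_eq)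
    ultimately show ?thesis by (metis card_image)
  qed
  define L T where "L = X (\<lambda>a. a \<le> 1)" and "T = X (\<lambda>a. 3 \<le> a)"
  have LT: "finite L" "finite T" "L \<subseteq> {..<length xs}" "T \<subseteq> {..<length xs}"
    by (auto simp: L_def T_def X_def)
  have card: "card L = i" "card T = i"
    using card_colours[of "\<lambda>a. a \<le> 1"] card_colours[of "\<lambda>a. 3 \<le> a"] ki
    by (simp_all add: L_def T_def cardX)
  have edge: "4 \<le> c (xs ! j) + c (xs ! s j)" if "j < length xs" for j
    using cyc[OF that] adj_threshold xs(3) simple_adjD[OF G] unfolding s_def by blast
  have "s ` L \<subseteq> T"
  proof
    fix j' assume "j' \<in> s ` L"
    then obtain j where "j \<in> L" "j' = s j" by blast
    then show "j' \<in> T" using edge[of j] s_lt[of j] by (auto simp: L_def T_def X_def)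
  qed
  moreover have "card (s ` L) = card T"
    using card inj LT(3) by (metis card_image inj_on_subset)
  ultimately have sL: "s ` L = T" using card_subset_eq[OF LT(2)] by blast
  \<comment> \<open>\<open>L'\<close> consists of the predecessors of \<open>L\<close>. Equal
    cardinality again turns inclusion in \<open>T\<close> into equality, so successors of
    \<open>T\<close> lie in \<open>L\<close>.\<close>
  define L' where "L' = {j. j < length xs \<and> s j \<in> L}"
  have "L' \<subseteq> T"
  proof
    fix j assume "j \<in> L'"
    then show "j \<in> T" using edge[of j] by (auto simp: L_def T_def X_def L'_def)
  qed
  moreover have "card L' = card T"
  proof -
    have "s ` L' = L" using bij LT(3) by (auto simp: L'_def image_iff)
    moreover have "inj_on s L'" using inj by (rule inj_on_subset) (auto simp: L'_def)
    ultimately show ?thesis using card by (metis card_image)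
  qed
  ultimately have sT: "L' = T" using card_subset_eq[OF LT(2)] by blast
  have closed: "s j \<in> L \<union> T" if "j \<in> L \<union> T" for j
    using that sL sT by (auto simp: L'_def)
  have "L \<noteq> {}" using card ki by auto
  then obtain j0 where j0: "j0 \<in> L" by blast
  \<comment> \<open>Starting in \<open>L\<close>, repeated successors stay in
    \<open>L \<union> T\<close> and run through the whole cycle.\<close>
  have all: "(j0 + t) mod length xs \<in> L \<union> T" for t
  proof (induction t)
    case 0 then show ?case using j0 LT(3) by auto
  next
    case (Suc t)
    then show ?case using closed[OF Suc] by (simp add: s_def mod_Suc_eq)
  qed
  have "j \<in> L \<union> T" if "j < length xs" for j
  proof -
    have "j0 < length xs" using j0 LT(3) by auto
    then have "(j0 + (length xs - j0 + j)) mod length xs = j" using that by simp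
    then show ?thesis using all by metis
  qed
  moreover have "card (X (\<lambda>a. a = 2)) = n - 2 * i"
    unfolding cardX using c by (simp add: threshold_colouring_def)
  then have "X (\<lambda>a. a = 2) \<noteq> {}" using ki by auto
  ultimately show False by (fastforce simp: L_def T_def X_def)
qed

lemma nonham_graph_threshold: "nonham_graph n k G"
  by (simp add: nonham_graph_def G graph_order_threshold connectivity_threshold not_hamiltonian_threshold)

end

text \<open>The parameters fix the size of every colour class, and adjacency depends only on the
  colours; bijections between equal classes therefore glue to an isomorphism.\<close>

lemma threshold_colouring_iso:
  assumes G: "finite (verts G)" "threshold_colouring n k i G c"
    and H: "finite (verts H)" "threshold_colouring n k i H d"
  shows "G \<simeq> H"
proof -
  have "\<exists>f. bij_betw f {x \<in> verts G. c x = j} {x \<in> verts H. d x = j}" for j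
  proof (intro finite_same_card_bij)
    show "card {x \<in> verts G. c x = j} = card {x \<in> verts H. d x = j}"
      using card_over_colours[OF G, of "\<lambda>a. a = j"] card_over_colours[OF H, of "\<lambda>a. a = j"] by simp
  qed (use G H in auto)
  then obtain f where f: "\<And>j. bij_betw (f j) {x \<in> verts G. c x = j} {x \<in> verts H. d x = j}" by metis
  define g where "g x = f (c x) x" for x
  have g: "g x \<in> verts H" "d (g x) = c x" if "x \<in> verts G" for x
    using bij_betwE[OF f[of "c x"]] that by (auto simp: g_def)
  have inj: "x = y" if "x \<in> verts G" "y \<in> verts G" "g x = g y" for x y
  proof -
    have "c x = c y" using g that by metis
    then show ?thesis using bij_betw_imp_inj_on[OF f[of "c x"]] that by (auto simp: g_def inj_on_def)
  qed
  have "verts H \<subseteq> g ` verts G"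
  proof
    fix y assume "y \<in> verts H"
    then have "y \<in> f (d y) ` {x \<in> verts G. c x = d y}" using f[of "d y"] by (auto simp: bij_betw_def)
    then obtain x where "x \<in> verts G" "c x = d y" "y = f (d y) x" by blast
    then show "y \<in> g ` verts G" by (intro image_eqI[of _ _ x]) (simp_all add: g_def)
  qed
  then have "bij_betw g (verts G) (verts H)"
    using g inj by (auto simp: bij_betw_def inj_on_def)
  moreover have "adj G x y \<longleftrightarrow> adj H (g x) (g y)" if "x \<in> verts G" "y \<in> verts G" for x y
    using G(2) H(2) g that inj[OF that] by (auto simp: threshold_colouring_def)
  ultimately show ?thesis unfolding graph_iso_def by blast
qed

lemma threshold_colouring_pullback:
  assumes "G \<simeq> H" "threshold_colouring n k i H d"
  shows "\<exists>c. threshold_colouring n k i G c"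
proof -
  obtain f where f: "bij_betw f (verts G) (verts H)"
    and adj: "\<And>u v. u \<in> verts G \<Longrightarrow> v \<in> verts G \<Longrightarrow> adj G u v \<longleftrightarrow> adj H (f u) (f v)"
    using assms(1) unfolding graph_iso_def by blast
  have fV: "f x \<in> verts H" if "x \<in> verts G" for x using bij_betwE[OF f] that by blast
  have inj: "f x = f y \<longleftrightarrow> x = y" if "x \<in> verts G" "y \<in> verts G" for x y
    using bij_betw_imp_inj_on[OF f] that by (auto simp: inj_on_def)
  have card: "card {x \<in> verts G. d (f x) = j} = card {y \<in> verts H. d y = j}" for j
  proof (rule bij_betw_same_card)
    have "f ` {x \<in> verts G. d (f x) = j} = {y \<in> verts H. d y = j}"
      using f by (auto simp: bij_betw_def)
    then show "bij_betw f {x \<in> verts G. d (f x) = j} {y \<in> verts H. d y = j}"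
      using inj by (auto simp: bij_betw_def inj_on_def)
  qed
  show ?thesis
    by (rule exI[of _ "\<lambda>x. d (f x)"])
      (use assms(2) fV inj adj in \<open>simp add: threshold_colouring_def card\<close>)
qed

text \<open>Being isomorphic to a named extremal graph becomes the existence of a colouring, the
  form in which the equality case delivers its result.\<close>

lemma iso_iff_threshold_colouring:
  assumes "finite (verts G)" "finite (verts H)" "threshold_colouring n k i H d"
  shows "G \<simeq> H \<longleftrightarrow> (\<exists>c. threshold_colouring n k i G c)"
  using assms threshold_colouring_iso threshold_colouring_pullback by metis

text \<open>\<open>max_nonham_size\<close> ranges over graphs on natural numbers, so attainment
  needs a witness of that type; its colour classes are consecutive intervals.\<close>

lemma ex_threshold_graph:
  assumes "1 \<le> k" "k \<le> i" "2 * i < n"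
  shows "\<exists>(G :: nat ugraph) c. simple_graph G \<and> threshold_colouring n k i G c"
proof -
  define c :: "nat \<Rightarrow> nat" where
    "c x = (if x < 1 then 0 else if x < i then 1 else if x < n - i then 2 else if x < n - k then 3 else 4)" for x
  define G where "G = \<lparr>verts = {..<n}, edges = {{x, y} | x y. x < n \<and> y < n \<and> x \<noteq> y \<and> 4 \<le> c x + c y}\<rparr>"
  have "simple_graph G" by (auto simp: simple_graph_def G_def all_pairs_def)
  moreover have "{x \<in> verts G. c x = 0} = {0}" "{x \<in> verts G. c x = 1} = {1..<i}"
    "{x \<in> verts G. c x = 2} = {i..<n - i}" "{x \<in> verts G. c x = 3} = {n - i..<n - k}"
    "{x \<in> verts G. c x = 4} = {n - k..<n}"
    using assms by (auto simp: G_def c_def split: if_splits)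
  moreover have "adj G x y \<longleftrightarrow> x \<noteq> y \<and> 4 \<le> c x + c y" if "x \<in> verts G" "y \<in> verts G" for x y
    using that by (auto simp: adj_def G_def doubleton_eq_iff add.commute)
  ultimately show ?thesis
    using assms by (intro exI[of _ G] exI[of _ c]) (simp add: threshold_colouring_def c_def)
qed

section \<open>Colourings of the named extremal graphs\<close>

lemma card_Plus_Collect:
  assumes "finite A" "finite B"
  shows "card {x \<in> A <+> B. P x} = card {a \<in> A. P (Inl a)} + card {b \<in> B. P (Inr b)}"
proof -
  have "{x \<in> A <+> B. P x} = {a \<in> A. P (Inl a)} <+> {b \<in> B. P (Inr b)}" by auto
  then show ?thesis using assms by (simp add: card_Plus)
qed

text \<open>For \<open>i = k\<close> colour 3 is absent, so colours 0 and 1 have the same neighbours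
  and the vertex given colour 0 is an arbitrary choice.\<close>

lemma threshold_colouring_join:
  assumes "1 \<le> k" "2 * k < n"
  shows "\<exists>c. threshold_colouring n k k (\<K> k \<nabla> (\<K> (n - 2 * k) \<oplus> graph_compl (\<K> k))) c"
proof -
  define c :: "nat + nat + nat \<Rightarrow> nat" where
    "c = case_sum (\<lambda>_. 4) (case_sum (\<lambda>_. 2) (\<lambda>b. if b = 0 then 0 else 1))"
  let ?G = "\<K> k \<nabla> (\<K> (n - 2 * k) \<oplus> graph_compl (\<K> k))"
  have c_simps: "c (Inl a) = 4" "c (Inr (Inl a')) = 2" "c (Inr (Inr b)) = (if b = 0 then 0 else 1)"
    for a a' b by (simp_all add: c_def)
  have "{b. b < k \<and> (if b = 0 then 0 else 1) = (0::nat)} = {0}"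
    "{b. b < k \<and> (if b = 0 then 0 else 1) = (1::nat)} = {1..<k}"
    using assms by (auto split: if_splits)
  then have *: "card {b. b < k \<and> (if b = 0 then 0 else 1) = (0::nat)} = 1"
    "card {b. b < k \<and> (if b = 0 then 0 else 1) = (1::nat)} = k - 1"
    by (simp_all only: card_atLeastLessThan) simp_all
  have adj: "adj ?G x y \<longleftrightarrow> x \<noteq> y \<and> 4 \<le> c x + c y" if "x \<in> verts ?G" "y \<in> verts ?G" for x y
    using that
    by (auto simp: c_simps adj_graph_join adj_disj_union adj_complete_graph adj_compl_complete_graph
        split: if_splits)
  have V: "verts ?G = {..<k} <+> ({..<n - 2 * k} <+> {..<k})" by simp
  have cards: "card {x \<in> verts ?G. c x = j} = (if j = 4 then k else 0) + ((if j = 2 then n - 2 * k else 0) +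
    card {b. b < k \<and> (if b = 0 then 0 else 1) = j})" for j
    unfolding V by (subst card_Plus_Collect, simp, simp, subst card_Plus_Collect) (auto simp: c_simps)
  have no: "card {b. b < k \<and> (if b = 0 then 0 else 1) = j} = 0" if "1 < j" for j :: nat
    using that by (auto simp: card_eq_0_iff)
  have le: "c x \<le> 4" for x by (cases x; cases "projr x") (auto simp: c_def split: sum.split)
  show ?thesis
    unfolding threshold_colouring_def
    by (rule exI[of _ c], unfold cards)
      (use adj le in \<open>simp add: no * del: One_nat_def verts_simps\<close>)
qed

lemma card_colours_deleted:
  assumes "k \<le> m"
  shows "card {a. a < m \<and> (if a < k then 4 else 3) = (3::nat)} = m - k"
    "card {a. a < m \<and> (if a < k then 4 else 3) = (4::nat)} = k"
proof -
  have "{a. a < m \<and> (if a < k then 4 else 3) = (3::nat)} = {k..<m}"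
    "{a. a < m \<and> (if a < k then 4 else 3) = (4::nat)} = {..<k}"
    using assms by (auto split: if_splits)
  then show "card {a. a < m \<and> (if a < k then 4 else 3) = (3::nat)} = m - k"
    "card {a. a < m \<and> (if a < k then 4 else 3) = (4::nat)} = k"
    by (simp_all only: card_atLeastLessThan card_lessThan)
qed

lemma mem_deleted_edges:
  "{Inl a, Inr b} \<in> {{Inl i, Inr w} | i. k \<le> i \<and> i < m} \<longleftrightarrow> b = w \<and> k \<le> a \<and> a < m"
  "{Inr b, Inl a} \<in> {{Inl i, Inr w} | i. k \<le> i \<and> i < m} \<longleftrightarrow> b = w \<and> k \<le> a \<and> a < m"
  "{Inl a, Inl a'} \<notin> {{Inl i, Inr w} | i. k \<le> i \<and> i < m}"
  "{Inr b, Inr b'} \<notin> {{Inl i, Inr w} | i. k \<le> i \<and> i < m}"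
  by (auto simp: doubleton_eq_iff)

lemma threshold_colouring_G\<^sub>1:
  assumes "1 \<le> k" "k \<le> m" "n = 2 * m + 1"
  shows "\<exists>c. threshold_colouring n k m (G\<^sub>1 n k) c"
proof -
  define c :: "nat + nat \<Rightarrow> nat" where
    \<comment> \<open>Vertex \<open>m\<close> of the independent part is the only one of colour 2,
      hence adjacent just to the complete part, as the graph requires.\<close>
    "c = case_sum (\<lambda>a. if a < k then 4 else 3) (\<lambda>b. if b = 0 then 0 else if b = m then 2 else 1)"
  have c_simps: "c (Inl a) = (if a < k then 4 else 3)"
    "c (Inr b) = (if b = 0 then 0 else if b = m then 2 else 1)" for a b by (simp_all add: c_def)
  have m: "(n - 1) div 2 = m" "(n + 1) div 2 = m + 1" using assms by simp_all
  have "{b. b < m + 1 \<and> (if b = 0 then 0 else if b = m then 2 else 1) = (0::nat)} = {0}"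
    "{b. b < m + 1 \<and> (if b = 0 then 0 else if b = m then 2 else 1) = (1::nat)} = {1..<m}"
    "{b. b < m + 1 \<and> (if b = 0 then 0 else if b = m then 2 else 1) = (2::nat)} = {m}"
    using assms by (auto split: if_splits)
  then have *: "card {b. b < m + 1 \<and> (if b = 0 then 0 else if b = m then 2 else 1) = (0::nat)} = 1"
    "card {b. b < m + 1 \<and> (if b = 0 then 0 else if b = m then 2 else 1) = (1::nat)} = m - 1"
    "card {b. b < m + 1 \<and> (if b = 0 then 0 else if b = m then 2 else 1) = (2::nat)} = 1"
    by (simp_all only: card_atLeastLessThan) simp_all
  have V: "verts (G\<^sub>1 n k) = {..<m} <+> {..<m + 1}" by (simp only: G\<^sub>1_def verts_simps m)
  have cards: "card {x \<in> verts (G\<^sub>1 n k). c x = j} =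
    card {a. a < m \<and> (if a < k then 4 else 3) = j} +
    card {b. b < m + 1 \<and> (if b = 0 then 0 else if b = m then 2 else 1) = j}" for j
    unfolding V by (subst card_Plus_Collect) (simp_all add: c_simps)
  have no: "card {a. a < m \<and> (if a < k then 4 else 3) = j} = 0" if "j < 3" for j :: nat
    using that by (auto simp: card_eq_0_iff)
  have no': "card {b. b < m + 1 \<and> (if b = 0 then 0 else if b = m then 2 else 1) = j} = 0" if "2 < j" for j :: nat
    using that by (auto simp: card_eq_0_iff)
  define D :: "(nat + nat) set set" where "D = {{Inl i, Inr 0} | i. k \<le> i \<and> i < m}"
  note D = mem_deleted_edges[where w = "0 :: nat" and k = k and m = m, folded D_def]
  have G: "G\<^sub>1 n k = delete_edges (\<K> m \<nabla> graph_compl (\<K> (m + 1))) D"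
    unfolding G\<^sub>1_def m D_def ..
  have adj: "adj (G\<^sub>1 n k) x y \<longleftrightarrow> x \<noteq> y \<and> 4 \<le> c x + c y"
    if "x \<in> verts (G\<^sub>1 n k)" "y \<in> verts (G\<^sub>1 n k)" for x y
    using that assms(1,2) unfolding V unfolding G adj_delete_edges
    by (cases x; cases y) (auto simp: D c_simps adj_graph_join adj_complete_graph
        adj_compl_complete_graph)
  have le: "c x \<le> 4" for x by (cases x) (simp_all add: c_simps)
  show ?thesis
    unfolding threshold_colouring_def
    by (rule exI[of _ c], unfold cards)
      (use adj le in \<open>simp add: no no' assms(3) card_colours_deleted[OF assms(2)] * del: One_nat_def\<close>)
qed

lemma threshold_colouring_G\<^sub>2:
  assumes "1 \<le> k" "k \<le> m" "n = 2 * m + 2"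
  shows "\<exists>c. threshold_colouring n k m (G\<^sub>2 n k) c"
proof -
  define c :: "nat + nat + nat \<Rightarrow> nat" where
    "c = case_sum (\<lambda>a. if a < k then 4 else 3) (case_sum (\<lambda>_. 2) (\<lambda>b. if b = 0 then 0 else 1))"
  have c_simps: "c (Inl a) = (if a < k then 4 else 3)" "c (Inr (Inl a')) = 2"
    "c (Inr (Inr b)) = (if b = 0 then 0 else 1)" for a a' b by (simp_all add: c_def)
  have m: "(n - 2) div 2 = m" using assms by simp
  have "{b. b < m \<and> (if b = 0 then 0 else 1) = (0::nat)} = {0}"
    "{b. b < m \<and> (if b = 0 then 0 else 1) = (1::nat)} = {1..<m}"
    using assms by (auto split: if_splits)
  then have *: "card {b. b < m \<and> (if b = 0 then 0 else 1) = (0::nat)} = 1"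
    "card {b. b < m \<and> (if b = 0 then 0 else 1) = (1::nat)} = m - 1"
    by (simp_all only: card_atLeastLessThan) simp_all
  have V: "verts (G\<^sub>2 n k) = {..<m} <+> ({..<2} <+> {..<m})" by (simp add: G\<^sub>2_def m)
  have cards: "card {x \<in> verts (G\<^sub>2 n k). c x = j} =
    card {a. a < m \<and> (if a < k then 4 else 3) = j} + ((if j = 2 then 2 else 0) +
    card {b. b < m \<and> (if b = 0 then 0 else 1) = j})" for j
    unfolding V by (subst card_Plus_Collect, simp, simp, subst card_Plus_Collect) (auto simp: c_simps)
  have no: "card {a. a < m \<and> (if a < k then 4 else 3) = j} = 0" if "j < 3" for j :: nat
    using that by (auto simp: card_eq_0_iff)
  have no': "card {b. b < m \<and> (if b = 0 then 0 else 1) = j} = 0" if "1 < j" for j :: nat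
    using that by (auto simp: card_eq_0_iff)
  define D :: "(nat + nat + nat) set set" where "D = {{Inl i, Inr (Inr 0)} | i. k \<le> i \<and> i < m}"
  note D = mem_deleted_edges[where w = "Inr 0 :: nat + nat" and k = k and m = m, folded D_def]
  have G: "G\<^sub>2 n k = delete_edges (\<K> m \<nabla> (\<K> 2 \<oplus> graph_compl (\<K> m))) D"
    unfolding G\<^sub>2_def m D_def ..
  have adj: "adj (G\<^sub>2 n k) x y \<longleftrightarrow> x \<noteq> y \<and> 4 \<le> c x + c y"
    if "x \<in> verts (G\<^sub>2 n k)" "y \<in> verts (G\<^sub>2 n k)" for x y
    using that assms(1,2) unfolding V unfolding G adj_delete_edges
    by (cases x; cases y; (cases "projr x")?; (cases "projr y")?)
      (auto simp: D c_simps adj_graph_join adj_disj_union adj_complete_graph adj_compl_complete_graph)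
  have le: "c x \<le> 4" for x by (cases x; cases "projr x") (auto simp: c_def split: sum.split)
  show ?thesis
    unfolding threshold_colouring_def
    by (rule exI[of _ c], unfold cards)
      (use adj le in \<open>simp add: no no' assms(3) card_colours_deleted[OF assms(2)] * del: One_nat_def\<close>)
qed

subsection \<open>Maximizing over the degree parameter\<close>

lemma twice_extremal_size_int:
  assumes "k \<le> i" "2 * i < n"
  shows "2 * int (extremal_size n k i) =
    int i * int i + (int n - 2 * int i) * (int n - 1 - int i) + int i * (int n - 1) - 2 * (int i - int k)"
proof -
  obtain r where n: "n = 2 * i + 1 + r" using assms(2) less_iff_Suc_add by (metis Suc_eq_plus1 add_Suc)
  have "int (2 * extremal_size n k i + 2 * (i - k)) =
    int (i * i + (n - 2 * i) * (n - 1 - i) + i * (n - 1))"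
    using twice_extremal_size[OF assms(2), of k] by simp
  then have "2 * int (extremal_size n k i) + 2 * (int i - int k) =
    int i * int i + (1 + int r) * (int i + int r) + int i * (2 * int i + int r)"
    using assms(1) by (simp add: n of_nat_diff algebra_simps)
  then show ?thesis by (simp add: n algebra_simps)
qed

text \<open>The second factor increases in both \<open>i\<close> and \<open>j\<close>; this is the
  convexity behind the maximization.\<close>

lemma extremal_size_diff:
  assumes "k \<le> j" "j \<le> i" "2 * i < n"
  shows "2 * (int (extremal_size n k i) - int (extremal_size n k j)) =
    (int i - int j) * (3 * int i + 3 * int j - 2 * int n - 1)"
  using twice_extremal_size_int[of k i n] twice_extremal_size_int[of k j n] assms
  by (simp add: algebra_simps)

text \<open>If the step from \<open>k\<close> to \<open>i\<close> does not decrease the value, then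
  by convexity the step from \<open>i\<close> to \<open>m\<close> strictly increases it.\<close>

lemma extremal_size_less_max:
  assumes "k < i" "i < m" "2 * m < n"
  shows "extremal_size n k i < max (extremal_size n k k) (extremal_size n k m)"
proof (cases "3 * int i + 3 * int k - 2 * int n - 1 < 0")
  case True
  then have "(int i - int k) * (3 * int i + 3 * int k - 2 * int n - 1) < 0"
    using assms by (simp add: mult_less_0_iff)
  then have "2 * (int (extremal_size n k i) - int (extremal_size n k k)) < 0"
    using extremal_size_diff[of k k i n] assms by simp
  then show ?thesis by simp
next
  case False
  then have "0 < (int m - int i) * (3 * int m + 3 * int i - 2 * int n - 1)"
    using assms by (intro mult_pos_pos) linarith+
  then have "0 < 2 * (int (extremal_size n k m) - int (extremal_size n k i))"
    using extremal_size_diff[of k i m n] assms by simp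
  then show ?thesis by simp
qed

lemma extremal_size_less_of_connectivity_one:
  assumes "1 < i" "2 * i < n"
  shows "extremal_size n 1 i < extremal_size n 1 1"
proof -
  have "3 * int i + 3 * 1 - 2 * int n - 1 < 0" using assms by linarith
  then have "(int i - 1) * (3 * int i + 3 * 1 - 2 * int n - 1) < 0"
    using assms by (simp add: mult_less_0_iff)
  then show ?thesis using extremal_size_diff[of 1 1 i n] assms by simp
qed

context
  fixes n k m :: nat
  assumes k: "1 \<le> k" "2 * k + 1 \<le> n" and m: "m = (n - 1) div 2"
begin

lemma km: "k \<le> m" "2 * m < n" and kn: "2 * k < n"
  using k m by auto

text \<open>The inequalities in the second part record which end of the range attains the maximum;
  in a tie both families qualify. The vertex type is arbitrary, so the bound holds for the witnesses
  on natural numbers and for the graphs of the theorem alike.\<close>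

lemma nonham_size_le_max:
  assumes "nonham_graph n k G"
  shows "graph_size G \<le> max (extremal_size n k k) (extremal_size n k m)"
    and "graph_size G = max (extremal_size n k k) (extremal_size n k m) \<Longrightarrow>
      (\<exists>c. threshold_colouring n k k G c) \<and> extremal_size n k m \<le> extremal_size n k k \<or>
      (\<exists>c. threshold_colouring n k m G c) \<and> extremal_size n k k \<le> extremal_size n k m"
proof -
  obtain i where i: "k \<le> i" "2 * i < n" "graph_size G \<le> extremal_size n k i"
    "graph_size G = extremal_size n k i \<Longrightarrow> (\<exists>c. threshold_colouring n k i G c) \<or> k = 1 \<and> 1 < i"
    using nonham_size_bound[OF assms k] by metis
  have "i \<le> m" using i(2) m by linarith
  then have cases: "i = k \<or> i = m \<or> k < i \<and> i < m" using i(1) by linarith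
  then have le: "extremal_size n k i \<le> max (extremal_size n k k) (extremal_size n k m)"
    using extremal_size_less_max[of k i m n] km(2) by auto
  then show "graph_size G \<le> max (extremal_size n k k) (extremal_size n k m)" using i(3) by simp
  assume eq: "graph_size G = max (extremal_size n k k) (extremal_size n k m)"
  then have *: "graph_size G = extremal_size n k i" using le i(3) by linarith
  have "\<not> (k = 1 \<and> 1 < i)"
    using extremal_size_less_of_connectivity_one[OF _ i(2)] eq * by fastforce
  then have "\<exists>c. threshold_colouring n k i G c" using i(4)[OF *] by blast
  moreover have "i = k \<or> i = m"
    using cases extremal_size_less_max[of k i m n] km(2) eq * by auto
  moreover have "extremal_size n k k \<le> extremal_size n k i" "extremal_size n k m \<le> extremal_size n k i"
    using eq * by linarith+
  ultimately show "(\<exists>c. threshold_colouring n k k G c) \<and> extremal_size n k m \<le> extremal_size n k k \<or>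
      (\<exists>c. threshold_colouring n k m G c) \<and> extremal_size n k k \<le> extremal_size n k m"
    by blast
qed

lemma max_nonham_size_eq:
  "max_nonham_size n k = max (extremal_size n k k) (extremal_size n k m)"
  unfolding max_nonham_size_def
proof (rule Max_eqI)
  let ?A = "{graph_size G | G :: nat ugraph. nonham_graph n k G}"
  show le: "a \<le> max (extremal_size n k k) (extremal_size n k m)" if "a \<in> ?A" for a
    using that nonham_size_le_max(1) by blast
  show "finite ?A" by (rule finite_subset[OF _ finite_atMost]) (use le in blast)
  have "extremal_size n k i \<in> ?A" if i: "k \<le> i" "2 * i < n" for i
  proof -
    obtain G :: "nat ugraph" and c where G: "simple_graph G" "threshold_colouring n k i G c"
      using ex_threshold_graph[OF k(1) i] by blast
    have "nonham_graph n k G" "graph_size G = extremal_size n k i"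
      using nonham_graph_threshold[OF G k(1) i] graph_size_threshold[OF G k(1) i] by auto
    then show ?thesis by (metis (mono_tags, lifting) mem_Collect_eq)
  qed
  then show "max (extremal_size n k k) (extremal_size n k m) \<in> ?A"
    using km kn by (metis (no_types, lifting) max_def order_refl)
qed

lemma attains_max_iff:
  assumes "simple_graph G"
  shows "attains_max n k G \<longleftrightarrow>
    (\<exists>c. threshold_colouring n k k G c) \<and> extremal_size n k m \<le> extremal_size n k k \<or>
    (\<exists>c. threshold_colouring n k m G c) \<and> extremal_size n k k \<le> extremal_size n k m"
    (is "_ \<longleftrightarrow> ?r")
proof
  assume "attains_max n k G"
  then show ?r using nonham_size_le_max(2)[of G] by (simp add: attains_max_def max_nonham_size_eq)
next
  assume ?r
  then obtain i c where i: "k \<le> i" "2 * i < n" "threshold_colouring n k i G c"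
    "extremal_size n k i = max (extremal_size n k k) (extremal_size n k m)"
    using km kn by (metis max.absorb1 max.absorb2 order_refl)
  then show "attains_max n k G"
    using nonham_graph_threshold[OF assms i(3) k(1) i(1,2)] graph_size_threshold[OF assms i(3) k(1) i(1,2)]
    by (simp add: attains_max_def max_nonham_size_eq)
qed

lemma iso_join_iff:
  assumes "simple_graph G"
  shows "G \<simeq> \<K> k \<nabla> (\<K> (n - 2 * k) \<oplus> graph_compl (\<K> k)) \<longleftrightarrow> (\<exists>c. threshold_colouring n k k G c)"
proof -
  let ?H = "\<K> k \<nabla> (\<K> (n - 2 * k) \<oplus> graph_compl (\<K> k))"
  obtain d where "threshold_colouring n k k ?H d"
    using threshold_colouring_join[OF k(1) kn] by blast
  moreover have "finite (verts ?H)" by simp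
  ultimately show ?thesis using iso_iff_threshold_colouring simple_finite_verts[OF assms] by blast
qed

lemma iso_G\<^sub>1_iff:
  assumes "simple_graph G" "odd n"
  shows "G \<simeq> G\<^sub>1 n k \<longleftrightarrow> (\<exists>c. threshold_colouring n k m G c)"
proof -
  have "n = 2 * m + 1" using assms(2) m by simp
  then obtain d where "threshold_colouring n k m (G\<^sub>1 n k) d"
    using threshold_colouring_G\<^sub>1[OF k(1) km(1)] by blast
  moreover have "finite (verts (G\<^sub>1 n k))" by (simp add: G\<^sub>1_def)
  ultimately show ?thesis using iso_iff_threshold_colouring simple_finite_verts[OF assms(1)] by blast
qed

lemma iso_G\<^sub>2_iff:
  assumes "simple_graph G" "even n"
  shows "G \<simeq> G\<^sub>2 n k \<longleftrightarrow> (\<exists>c. threshold_colouring n k m G c)"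
proof -
  have "n = 2 * m + 2" using assms(2) m k by (auto elim!: evenE)
  then obtain d where "threshold_colouring n k m (G\<^sub>2 n k) d"
    using threshold_colouring_G\<^sub>2[OF k(1) km(1)] by blast
  moreover have "finite (verts (G\<^sub>2 n k))" by (simp add: G\<^sub>2_def)
  ultimately show ?thesis using iso_iff_threshold_colouring simple_finite_verts[OF assms(1)] by blast
qed

text \<open>Substituting \<open>n = 2 * m + 1\<close> into twice the factor
  \<open>3m + 3k - 2n - 1\<close> gives \<open>6k - 5 - n\<close>, the threshold for odd
  order.\<close>

lemma extremal_size_odd:
  assumes "odd n"
  shows "4 * (int (extremal_size n k m) - int (extremal_size n k k)) =
    (int m - int k) * (6 * int k - 5 - int n)"
    and "real (extremal_size n k m) = (3 * real n ^ 2 - 8 * real n + 5) / 8 + real k"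
proof -
  have n: "n = 2 * m + 1" using assms m by simp
  show "4 * (int (extremal_size n k m) - int (extremal_size n k k)) =
    (int m - int k) * (6 * int k - 5 - int n)"
    using extremal_size_diff[OF order_refl km] by (simp add: n algebra_simps)
  have "real_of_int (2 * int (extremal_size n k m)) = real_of_int
    (int m * int m + (int n - 2 * int m) * (int n - 1 - int m) + int m * (int n - 1) - 2 * (int m - int k))"
    unfolding twice_extremal_size_int[OF km] ..
  then show "real (extremal_size n k m) = (3 * real n ^ 2 - 8 * real n + 5) / 8 + real k"
    by (simp add: n field_simps power2_eq_square)
qed

text \<open>With \<open>n = 2 * m + 2\<close> the same factor doubles to
  \<open>6k - 8 - n\<close>.\<close>

lemma extremal_size_even:
  assumes "even n"
  shows "4 * (int (extremal_size n k m) - int (extremal_size n k k)) =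
    (int m - int k) * (6 * int k - 8 - int n)"
    and "real (extremal_size n k m) = (3 * real n ^ 2 - 10 * real n + 16) / 8 + real k"
proof -
  have n: "n = 2 * m + 2" using assms m k by (auto elim!: evenE)
  show "4 * (int (extremal_size n k m) - int (extremal_size n k k)) =
    (int m - int k) * (6 * int k - 8 - int n)"
    using extremal_size_diff[OF order_refl km] by (simp add: n algebra_simps)
  have "real_of_int (2 * int (extremal_size n k m)) = real_of_int
    (int m * int m + (int n - 2 * int m) * (int n - 1 - int m) + int m * (int n - 1) - 2 * (int m - int k))"
    unfolding twice_extremal_size_int[OF km] ..
  then show "real (extremal_size n k m) = (3 * real n ^ 2 - 10 * real n + 16) / 8 + real k"
    by (simp add: n field_simps power2_eq_square)
qed

end

lemma extremal_size_self: "extremal_size n k k = ((n - k) choose 2) + k ^ 2"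
  by (simp add: extremal_size_def)

text \<open>Applied with \<open>a\<close> the difference of \<open>m\<close> and \<open>k\<close>.
  The exception \<open>a = 0\<close> is the shortest range, where \<open>m = k\<close> and the two
  candidate families coincide.\<close>

lemma mult_sign_cases:
  fixes a b c :: int
  assumes "4 * c = a * b" "0 \<le> a"
  shows "b \<le> 0 \<Longrightarrow> c \<le> 0" "0 \<le> b \<Longrightarrow> 0 \<le> c"
    "b < 0 \<Longrightarrow> a = 0 \<or> c < 0" "0 < b \<Longrightarrow> a = 0 \<or> 0 < c"
proof -
  show "b \<le> 0 \<Longrightarrow> c \<le> 0" using assms mult_nonneg_nonpos[of a b] by linarith
  show "0 \<le> b \<Longrightarrow> 0 \<le> c" using assms mult_nonneg_nonneg[of a b] by linarith
  show "b < 0 \<Longrightarrow> a = 0 \<or> c < 0" using assms mult_pos_neg[of a b] by linarith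
  show "0 < b \<Longrightarrow> a = 0 \<or> 0 < c" using assms mult_pos_pos[of a b] by linarith
qed

theorem theorem8:
  fixes n k :: nat
  assumes "n \<ge> 1" and "k \<ge> 1" and "n \<ge> 2 * k + 1"
  shows
    "((odd n \<and> int n \<ge> 6 * int k - 5 \<or> even n \<and> int n \<ge> 6 * int k - 8) \<longrightarrow>
        max_nonham_size n k = ((n - k) choose 2) + k ^ 2) \<and>
     (odd n \<and> 2 * k + 1 \<le> n \<and> int n \<le> 6 * int k - 7 \<longrightarrow>
        real (max_nonham_size n k) = (3 * real n ^ 2 - 8 * real n + 5) / 8 + real k) \<and>
     (even n \<and> 2 * k + 2 \<le> n \<and> int n \<le> 6 * int k - 10 \<longrightarrow>
        real (max_nonham_size n k) = (3 * real n ^ 2 - 10 * real n + 16) / 8 + real k) \<and>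
     (\<forall>G :: 'a ugraph. simple_graph G \<longrightarrow>
        (int n = 6 * int k - 5 \<longrightarrow>
           (attains_max n k G \<longleftrightarrow>
              G \<simeq> \<K> k \<nabla> (\<K> (n - 2 * k) \<oplus> graph_compl (\<K> k)) \<or> G \<simeq> G\<^sub>1 n k)) \<and>
        (int n = 6 * int k - 8 \<longrightarrow>
           (attains_max n k G \<longleftrightarrow>
              G \<simeq> \<K> k \<nabla> (\<K> (n - 2 * k) \<oplus> graph_compl (\<K> k)) \<or> G \<simeq> G\<^sub>2 n k)) \<and>
        ((odd n \<and> int n \<ge> 6 * int k - 3 \<or> even n \<and> int n \<ge> 6 * int k - 6) \<longrightarrow>
           (attains_max n k G \<longleftrightarrow>
              G \<simeq> \<K> k \<nabla> (\<K> (n - 2 * k) \<oplus> graph_compl (\<K> k)))) \<and>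
        (odd n \<and> 2 * k + 1 \<le> n \<and> int n \<le> 6 * int k - 7 \<longrightarrow>
           (attains_max n k G \<longleftrightarrow> G \<simeq> G\<^sub>1 n k)) \<and>
        (even n \<and> 2 * k + 2 \<le> n \<and> int n \<le> 6 * int k - 10 \<longrightarrow>
           (attains_max n k G \<longleftrightarrow> G \<simeq> G\<^sub>2 n k)))"
proof -
  define m where "m = (n - 1) div 2"
  define p q where "p = extremal_size n k k" and "q = extremal_size n k m"
  note k = assms(2,3)
  have km: "k \<le> m" using km(1)[OF k m_def] .
  have max: "max_nonham_size n k = max p q"
    using max_nonham_size_eq[OF k m_def] by (simp add: p_def q_def)
  have p: "p = ((n - k) choose 2) + k ^ 2" by (simp add: p_def extremal_size_self)
  have km_nonneg: "0 \<le> int m - int k" using km by simp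
  note odd = extremal_size_odd[OF k m_def, folded p_def q_def]
  note even = extremal_size_even[OF k m_def, folded p_def q_def]
  note cmp_odd = mult_sign_cases[OF odd(1) km_nonneg] and cmp_even = mult_sign_cases[OF even(1) km_nonneg]
  have ge: "q \<le> p" if "odd n \<and> int n \<ge> 6 * int k - 5 \<or> even n \<and> int n \<ge> 6 * int k - 8"
    using that cmp_odd(1) cmp_even(1) by fastforce
  have le: "p \<le> q" if "odd n \<and> int n \<le> 6 * int k - 5 \<or> even n \<and> int n \<le> 6 * int k - 8"
    using that cmp_odd(2) cmp_even(2) by fastforce
  have gt: "m = k \<or> q < p" if "odd n \<and> int n > 6 * int k - 5 \<or> even n \<and> int n > 6 * int k - 8"
    using that cmp_odd(3) cmp_even(3) by fastforce
  have lt: "m = k \<or> p < q" if "odd n \<and> int n < 6 * int k - 5 \<or> even n \<and> int n < 6 * int k - 8"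
    using that cmp_odd(4) cmp_even(4) by fastforce
  have size_join: "odd n \<and> int n \<ge> 6 * int k - 5 \<or> even n \<and> int n \<ge> 6 * int k - 8 \<Longrightarrow>
      max_nonham_size n k = ((n - k) choose 2) + k ^ 2"
    using ge p max by simp
  have size_odd: "odd n \<and> 2 * k + 1 \<le> n \<and> int n \<le> 6 * int k - 7 \<Longrightarrow>
      real (max_nonham_size n k) = (3 * real n ^ 2 - 8 * real n + 5) / 8 + real k"
    using le odd(2) max by (simp add: max_absorb2)
  have size_even: "even n \<and> 2 * k + 2 \<le> n \<and> int n \<le> 6 * int k - 10 \<Longrightarrow>
      real (max_nonham_size n k) = (3 * real n ^ 2 - 10 * real n + 16) / 8 + real k"
    using le even(2) max by (simp add: max_absorb2)
  define P where "P i G \<longleftrightarrow> (\<exists>c. threshold_colouring n k i G c)" for i and G :: "'a ugraph"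
  have attains: "attains_max n k G \<longleftrightarrow> P k G \<and> q \<le> p \<or> P m G \<and> p \<le> q"
    if "simple_graph G" for G :: "'a ugraph"
    using attains_max_iff[OF k m_def that] by (simp add: P_def p_def q_def)
  have iso: "G \<simeq> \<K> k \<nabla> (\<K> (n - 2 * k) \<oplus> graph_compl (\<K> k)) \<longleftrightarrow> P k G"
    "odd n \<Longrightarrow> G \<simeq> G\<^sub>1 n k \<longleftrightarrow> P m G" "even n \<Longrightarrow> G \<simeq> G\<^sub>2 n k \<longleftrightarrow> P m G"
    if "simple_graph G" for G :: "'a ugraph"
    unfolding P_def
    using iso_join_iff[OF k m_def that] iso_G\<^sub>1_iff[OF k m_def that] iso_G\<^sub>2_iff[OF k m_def that] by blast+
  \<comment> \<open>The equation fixes the parity of \<open>n\<close>, and at the threshold both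
    comparisons hold.\<close>
  have eq1: "odd n" "p = q" if "int n = 6 * int k - 5"
  proof -
    show "odd n" using that by presburger
    then show "p = q" using ge le that by (metis le_antisym order_refl)
  qed
  have eq2: "even n" "p = q" if "int n = 6 * int k - 8"
  proof -
    show "even n" using that by presburger
    then show "p = q" using ge le that by (metis le_antisym order_refl)
  qed
  have graphs:
    "int n = 6 * int k - 5 \<Longrightarrow> attains_max n k G \<longleftrightarrow>
       G \<simeq> \<K> k \<nabla> (\<K> (n - 2 * k) \<oplus> graph_compl (\<K> k)) \<or> G \<simeq> G\<^sub>1 n k"
    "int n = 6 * int k - 8 \<Longrightarrow> attains_max n k G \<longleftrightarrow>
       G \<simeq> \<K> k \<nabla> (\<K> (n - 2 * k) \<oplus> graph_compl (\<K> k)) \<or> G \<simeq> G\<^sub>2 n k"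
    "odd n \<and> int n \<ge> 6 * int k - 3 \<or> even n \<and> int n \<ge> 6 * int k - 6 \<Longrightarrow>
       attains_max n k G \<longleftrightarrow> G \<simeq> \<K> k \<nabla> (\<K> (n - 2 * k) \<oplus> graph_compl (\<K> k))"
    "odd n \<and> 2 * k + 1 \<le> n \<and> int n \<le> 6 * int k - 7 \<Longrightarrow> attains_max n k G \<longleftrightarrow> G \<simeq> G\<^sub>1 n k"
    "even n \<and> 2 * k + 2 \<le> n \<and> int n \<le> 6 * int k - 10 \<Longrightarrow> attains_max n k G \<longleftrightarrow> G \<simeq> G\<^sub>2 n k"
    if G: "simple_graph G" for G :: "'a ugraph"
  proof -
    show "attains_max n k G \<longleftrightarrow> G \<simeq> \<K> k \<nabla> (\<K> (n - 2 * k) \<oplus> graph_compl (\<K> k)) \<or> G \<simeq> G\<^sub>1 n k"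
      if "int n = 6 * int k - 5"
      unfolding attains[OF G] iso(1)[OF G] iso(2)[OF G eq1(1)[OF that]] using eq1(2)[OF that] by simp
    show "attains_max n k G \<longleftrightarrow> G \<simeq> \<K> k \<nabla> (\<K> (n - 2 * k) \<oplus> graph_compl (\<K> k)) \<or> G \<simeq> G\<^sub>2 n k"
      if "int n = 6 * int k - 8"
      unfolding attains[OF G] iso(1)[OF G] iso(3)[OF G eq2(1)[OF that]] using eq2(2)[OF that] by simp
    show "attains_max n k G \<longleftrightarrow> G \<simeq> \<K> k \<nabla> (\<K> (n - 2 * k) \<oplus> graph_compl (\<K> k))"
      if "odd n \<and> int n \<ge> 6 * int k - 3 \<or> even n \<and> int n \<ge> 6 * int k - 6"
    proof -
      have "m = k \<or> q < p" by (rule gt) (use that in linarith)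
      then show ?thesis unfolding attains[OF G] iso(1)[OF G] by (auto simp: p_def q_def)
    qed
    show "attains_max n k G \<longleftrightarrow> G \<simeq> G\<^sub>1 n k" if "odd n \<and> 2 * k + 1 \<le> n \<and> int n \<le> 6 * int k - 7"
    proof -
      have "m = k \<or> p < q" by (rule lt) (use that in linarith)
      moreover have "odd n" using that by blast
      ultimately show ?thesis unfolding attains[OF G] iso(2)[OF G \<open>odd n\<close>] by (auto simp: p_def q_def)
    qed
    show "attains_max n k G \<longleftrightarrow> G \<simeq> G\<^sub>2 n k" if "even n \<and> 2 * k + 2 \<le> n \<and> int n \<le> 6 * int k - 10"
    proof -
      have "m = k \<or> p < q" by (rule lt) (use that in linarith)
      moreover have "even n" using that by blast
      ultimately show ?thesis unfolding attains[OF G] iso(3)[OF G \<open>even n\<close>] by (auto simp: p_def q_def)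
    qed
  qed
  show ?thesis using size_join size_odd size_even graphs by (intro conjI allI impI) simp_all
qed

end
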